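(* If $p>1$ and $p$ properly divides $q$, then $\mathrm{Out}(BS(p,q))$ is not finitely generated.
   Context: $BS(p,q)=\langle x,t\mid tx^pt^{-1}=x^q\rangle$ is the Baumslag–Solitar group. Here $p,q$ are nonzero integers, and "$p$ properly divides $q$" means $q=pn$ for an integer $n$ with $|n|>1$. $\mathrm{Out}$ denotes the outer automorphism group. *)

theory Defs
  imports "HOL-Algebra.Bij" "HOL-Algebra.Generated_Groups"
begin

section \<open>Groups given by generators and relations\<close>

text \<open>
  A word is a list of signed letters: \<open>(a, True)\<close> stands for the generator \<open>a\<close> and
  \<open>(a, False)\<close> for its formal inverse. A pair \<open>(u, v)\<close> in \<open>R\<close> is the defining relation \<open>u = v\<close>.
  All elements of the type \<open>'a\<close> are generators.
\<close>

type_synonym 'a word = "('a \<times> bool) list"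

inductive word_eq :: "('a word \<times> 'a word) set \<Rightarrow> 'a word \<Rightarrow> 'a word \<Rightarrow> bool"
  for R where
  rel: "(u, v) \<in> R \<Longrightarrow> word_eq R u v"
| cancel: "word_eq R [(a, b), (a, \<not> b)] []"
| refl: "word_eq R u u"
| sym: "word_eq R u v \<Longrightarrow> word_eq R v u"
| trans: "word_eq R u v \<Longrightarrow> word_eq R v w \<Longrightarrow> word_eq R u w"
| append: "word_eq R u u' \<Longrightarrow> word_eq R v v' \<Longrightarrow> word_eq R (u @ v) (u' @ v')"

definition word_class :: "('a word \<times> 'a word) set \<Rightarrow> 'a word \<Rightarrow> 'a word set" where
  "word_class R u = {v. word_eq R u v}"

definition presented_group :: "('a word \<times> 'a word) set \<Rightarrow> 'a word set monoid" where
  "presented_group R =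
    \<lparr>carrier = range (word_class R),
     mult = \<lambda>A B. \<Union>u\<in>A. \<Union>v\<in>B. word_class R (u @ v),
     one = word_class R []\<rparr>"

lemma word_class_eq_iff: "word_class R u = word_class R v \<longleftrightarrow> word_eq R u v"
  unfolding word_class_def by (blast intro: word_eq.refl word_eq.sym word_eq.trans)

lemma mult_word_class:
  "word_class R u \<otimes>\<^bsub>presented_group R\<^esub> word_class R v = word_class R (u @ v)"
proof -
  have *: "word_class R (u' @ v') = word_class R (u @ v)"
    if "u' \<in> word_class R u" "v' \<in> word_class R v" for u' v'
    using that unfolding word_class_eq_iff
    by (simp add: word_class_def word_eq.sym word_eq.append)
  have "u \<in> word_class R u" "v \<in> word_class R v"
    by (auto simp: word_class_def intro: word_eq.refl)
  then have "(\<Union>u'\<in>word_class R u. \<Union>v'\<in>word_class R v. word_class R (u' @ v')) = word_class R (u @ v)"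
    using * by blast
  then show ?thesis
    by (simp add: presented_group_def)
qed

definition word_inv :: "'a word \<Rightarrow> 'a word" where
  "word_inv u = rev (map (\<lambda>(a, b). (a, \<not> b)) u)"

lemma word_inv_append: "word_eq R (word_inv u @ u) []"
proof (induction u)
  case Nil
  show ?case by (simp add: word_inv_def word_eq.refl)
next
  case (Cons l u)
  obtain a b where l: "l = (a, b)" by force
  have "word_eq R [(a, \<not> b), (a, b)] []"
    using word_eq.cancel[of R a "\<not> b"] by simp
  then have "word_eq R (word_inv u @ ([(a, \<not> b), (a, b)] @ u)) (word_inv u @ ([] @ u))"
    by (intro word_eq.append word_eq.refl)
  then show ?case
    using Cons.IH by (auto simp: word_inv_def l intro: word_eq.trans)
qed

lemma group_presented_group: "group (presented_group R)"
proof (rule groupI)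
  fix A assume "A \<in> carrier (presented_group R)"
  then obtain u where "A = word_class R u"
    by (auto simp: presented_group_def)
  moreover have "word_class R (word_inv u) \<otimes>\<^bsub>presented_group R\<^esub> word_class R u
      = \<one>\<^bsub>presented_group R\<^esub>"
    unfolding mult_word_class
    by (simp add: presented_group_def word_class_eq_iff word_inv_append)
  ultimately show "\<exists>B\<in>carrier (presented_group R). B \<otimes>\<^bsub>presented_group R\<^esub> A = \<one>\<^bsub>presented_group R\<^esub>"
    by (intro bexI[where x = "word_class R (word_inv u)"]) (simp_all add: presented_group_def)
next
  have carr: "\<exists>u. A = word_class R u" if "A \<in> carrier (presented_group R)" for A
    using that by (auto simp: presented_group_def)
  have one: "\<one>\<^bsub>presented_group R\<^esub> = word_class R []"
    by (simp add: presented_group_def)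
  have cl: "word_class R u \<in> carrier (presented_group R)" for u
    by (simp add: presented_group_def)
  show "\<one>\<^bsub>presented_group R\<^esub> \<in> carrier (presented_group R)"
    by (simp add: one cl)
  fix A B assume A: "A \<in> carrier (presented_group R)" and B: "B \<in> carrier (presented_group R)"
  show "A \<otimes>\<^bsub>presented_group R\<^esub> B \<in> carrier (presented_group R)"
    using carr[OF A] carr[OF B] by (auto simp: mult_word_class cl)
  show "\<one>\<^bsub>presented_group R\<^esub> \<otimes>\<^bsub>presented_group R\<^esub> A = A"
    using carr[OF A] by (auto simp: mult_word_class one)
  fix C assume C: "C \<in> carrier (presented_group R)"
  show "A \<otimes>\<^bsub>presented_group R\<^esub> B \<otimes>\<^bsub>presented_group R\<^esub> C
      = A \<otimes>\<^bsub>presented_group R\<^esub> (B \<otimes>\<^bsub>presented_group R\<^esub> C)"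
    using carr[OF A] carr[OF B] carr[OF C] by (auto simp: mult_word_class)
qed

section \<open>Baumslag--Solitar groups\<close>

datatype bs_gen = Gen_x | Gen_t

definition word_pow :: "'a \<Rightarrow> int \<Rightarrow> 'a word" where
  "word_pow a n = replicate (nat \<bar>n\<bar>) (a, 0 \<le> n)"

definition BS :: "int \<Rightarrow> int \<Rightarrow> bs_gen word set monoid" where
  "BS p q = presented_group
     {(word_pow Gen_t 1 @ word_pow Gen_x p @ word_pow Gen_t (- 1), word_pow Gen_x q)}"

definition properly_divides :: "int \<Rightarrow> int \<Rightarrow> bool" where
  "properly_divides p q \<longleftrightarrow> (\<exists>n. q = p * n \<and> \<bar>n\<bar> > 1)"

section \<open>Outer automorphism groups and finite generation\<close>

definition inner_auto :: "('a, 'b) monoid_scheme \<Rightarrow> ('a \<Rightarrow> 'a) set" where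
  "inner_auto G = (\<lambda>g. \<lambda>h\<in>carrier G. g \<otimes>\<^bsub>G\<^esub> h \<otimes>\<^bsub>G\<^esub> inv\<^bsub>G\<^esub> g) ` carrier G"

definition Out :: "('a, 'b) monoid_scheme \<Rightarrow> ('a \<Rightarrow> 'a) set monoid" where
  "Out G = AutoGroup G Mod inner_auto G"

definition finitely_generated :: "('a, 'b) monoid_scheme \<Rightarrow> bool" where
  "finitely_generated G \<longleftrightarrow> (\<exists>S. finite S \<and> S \<subseteq> carrier G \<and> generate G S = carrier G)"

context group
begin

lemma inner_auto_subset: "inner_auto G \<subseteq> auto G"
proof
  fix f assume "f \<in> inner_auto G"
  then obtain g where g: "g \<in> carrier G" and f: "f = (\<lambda>h\<in>carrier G. g \<otimes> h \<otimes> inv g)"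
    by (auto simp: inner_auto_def)
  have cancel: "inv g \<otimes> (g \<otimes> h) = h" "g \<otimes> (inv g \<otimes> h) = h" if "h \<in> carrier G" for h
    using that g by (simp_all add: m_assoc[symmetric])
  have "f \<in> hom G G"
    by (rule homI) (simp_all add: f g m_assoc cancel)
  moreover have "bij_betw f (carrier G) (carrier G)"
    by (rule bij_betw_byWitness[where f' = "\<lambda>h. inv g \<otimes> h \<otimes> g"])
      (auto simp: f g m_assoc cancel)
  ultimately show "f \<in> auto G"
    by (simp add: auto_def Bij_def f)
qed

lemma normal_inner_auto: "inner_auto G \<lhd> AutoGroup G"
proof -
  interpret A: group "AutoGroup G" by (rule AutoGroup)
  define c where "c g = (\<lambda>h\<in>carrier G. g \<otimes> h \<otimes> inv g)" for g
  have inn: "inner_auto G = c ` carrier G"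
    by (simp add: inner_auto_def c_def)
  have carrA: "carrier (AutoGroup G) = auto G"
    by (simp add: AutoGroup_def)
  have multA: "f \<otimes>\<^bsub>AutoGroup G\<^esub> f' = compose (carrier G) f f'" if "f \<in> auto G" "f' \<in> auto G" for f f'
    using that by (simp add: AutoGroup_def BijGroup_def auto_def)
  have c_auto: "c g \<in> auto G" if "g \<in> carrier G" for g
    using inner_auto_subset that by (auto simp: inn)
  have "group_hom G (AutoGroup G) c"
  proof (unfold_locales, rule homI)
    fix g h assume gh: "g \<in> carrier G" "h \<in> carrier G"
    show "c g \<in> carrier (AutoGroup G)" using gh by (simp add: carrA c_auto)
    show "c (g \<otimes> h) = c g \<otimes>\<^bsub>AutoGroup G\<^esub> c h"
      unfolding multA[OF c_auto[OF gh(1)] c_auto[OF gh(2)]]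
      using gh by (auto simp: compose_def c_def m_assoc inv_mult_group)
  qed
  then have sub: "subgroup (inner_auto G) (AutoGroup G)"
    unfolding inn by (rule group_hom.img_is_subgroup)
  show ?thesis
    unfolding A.normal_inv_iff
  proof (intro conjI sub ballI)
    fix f k assume f: "f \<in> carrier (AutoGroup G)" and "k \<in> inner_auto G"
    then obtain g where g: "g \<in> carrier G" and k: "k = c g" by (auto simp: inn)
    have fa: "f \<in> auto G" and fh: "f \<in> hom G G"
      using f by (auto simp: carrA auto_def)
    interpret f: group_hom G G f
      using fh by unfold_locales
    have "f \<otimes>\<^bsub>AutoGroup G\<^esub> c g = c (f g) \<otimes>\<^bsub>AutoGroup G\<^esub> f"
      unfolding multA[OF fa c_auto[OF g]] multA[OF c_auto[OF f.hom_closed[OF g]] fa]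
      using g by (auto simp: compose_def c_def)
    then have "f \<otimes>\<^bsub>AutoGroup G\<^esub> c g \<otimes>\<^bsub>AutoGroup G\<^esub> inv\<^bsub>AutoGroup G\<^esub> f = c (f g)"
      using f c_auto[OF f.hom_closed[OF g]] A.r_inv[OF f] A.inv_closed[OF f]
      by (simp add: A.m_assoc carrA[symmetric] del: A.r_inv)
    then show "f \<otimes>\<^bsub>AutoGroup G\<^esub> k \<otimes>\<^bsub>AutoGroup G\<^esub> inv\<^bsub>AutoGroup G\<^esub> f \<in> inner_auto G"
      using g by (simp add: k inn)
  qed
qed

lemma group_Out: "group (Out G)"
  unfolding Out_def by (rule normal.factorgroup_is_group[OF normal_inner_auto])

end

end

theory Submission
  imports Defs Complex_Main
begin

text \<open>
  Write \<open>q = p n\<close> and map \<open>BS p q\<close> to the affine group of the line by \<open>x \<mapsto> (v \<mapsto> v + 1)\<close> and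
  \<open>t \<mapsto> (v \<mapsto> n v)\<close>; translation parts lie in \<open>\<int>[1/n]\<close>. Every automorphism \<open>\<alpha>\<close> sends \<open>x\<close> to a conjugate
  \<open>g x\<^sup>\<plusminus>\<^sup>1 g\<^sup>-\<^sup>1\<close>: an element whose \<open>p\<close>-th power is conjugate to its \<open>q\<close>-th power has no hyperbolic part,
  hence is conjugate to some \<open>x\<^sup>m\<close>, and \<open>p > 1\<close> makes \<open>x\<close> conjugate to no other power of itself. As the
  centralizer of \<open>x\<close> is \<open>\<langle>x\<rangle>\<close>, the translation part of \<open>g\<^sup>-\<^sup>1 \<alpha>(t) g\<close> is well defined modulo the integers. It
  vanishes on inner automorphisms and is additive up to signs under composition. So the automorphisms for
  which it lies in \<open>n\<^sup>-\<^sup>K \<int>\<close> form an increasing chain of subgroups, with union the whole automorphism group,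
  and finite generation would make the chain stationary. But for \<open>z = t\<^sup>-\<^sup>k x\<^sup>p t\<^sup>k\<close>, which commutes with
  \<open>x\<^sup>p\<close>, the automorphism \<open>x \<mapsto> z\<^sup>-\<^sup>1 x z\<close>, \<open>t \<mapsto> t\<close> has the value \<open>p (1 - n) / n\<^sup>k\<close>.
\<close>

section \<open>Homomorphisms out of presented groups\<close>

definition word_eval :: "('g, 'm) monoid_scheme \<Rightarrow> ('a \<Rightarrow> 'g) \<Rightarrow> 'a word \<Rightarrow> 'g" where
  "word_eval H f u =
    foldr (\<lambda>(a, b) y. (if b then f a else inv\<^bsub>H\<^esub> f a) \<otimes>\<^bsub>H\<^esub> y) u \<one>\<^bsub>H\<^esub>"

lemma word_eval_simps [simp]:
  "word_eval H f [] = \<one>\<^bsub>H\<^esub>"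
  "word_eval H f ((a, b) # u) = (if b then f a else inv\<^bsub>H\<^esub> f a) \<otimes>\<^bsub>H\<^esub> word_eval H f u"
  by (simp_all add: word_eval_def)

context group
begin

lemma word_eval_closed [simp, intro]:
  "(\<And>a. f a \<in> carrier G) \<Longrightarrow> word_eval G f u \<in> carrier G"
  by (induction u) auto

lemma word_eval_append:
  "(\<And>a. f a \<in> carrier G) \<Longrightarrow> word_eval G f (u @ v) = word_eval G f u \<otimes> word_eval G f v"
  by (induction u) (auto simp: m_assoc)

lemma word_eval_word_eq:
  assumes "word_eq R u v" and f: "\<And>a. f a \<in> carrier G"
    and R: "\<And>u v. (u, v) \<in> R \<Longrightarrow> word_eval G f u = word_eval G f v"
  shows "word_eval G f u = word_eval G f v"
  using assms(1) by induction (auto simp: word_eval_append f R)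

lemma word_eval_word_pow:
  assumes "\<And>a. f a \<in> carrier G"
  shows "word_eval G f (word_pow a k) = f a [^] k"
proof -
  have "word_eval G f (replicate m (a, True)) = f a [^] m" for m
    by (induction m) (use assms in \<open>simp_all add: nat_pow_Suc2[symmetric] del: nat_pow_Suc\<close>)
  moreover have "word_eval G f (replicate m (a, False)) = inv (f a [^] m)" for m
    by (induction m) (use assms in \<open>simp_all add: inv_mult_group\<close>)
  ultimately show ?thesis
    using assms int_pow_neg_int[of "f a" "nat (- k)"] by (cases "k \<ge> 0") (simp_all add: word_pow_def)
qed

text \<open>Von Dyck's theorem: evaluation respects \<open>word_eq\<close>, so all representatives
  of a class have the same value and \<open>THE\<close> picks it.\<close>

lemma presented_group_lift:
  assumes f: "\<And>a. f a \<in> carrier G"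
    and R: "\<And>u v. (u, v) \<in> R \<Longrightarrow> word_eval G f u = word_eval G f v"
  obtains h where "h \<in> hom (presented_group R) G"
    and "\<And>u. h (word_class R u) = word_eval G f u"
proof
  define h where "h A = (THE y. \<exists>u. A = word_class R u \<and> y = word_eval G f u)" for A
  show h: "h (word_class R u) = word_eval G f u" for u
    unfolding h_def
    using word_eval_word_eq[OF _ f R] word_eq.refl[of R]
    by (intro the_equality) (auto simp: word_class_eq_iff, metis)
  have [simp]: "carrier (presented_group R) = range (word_class R)"
    by (simp add: presented_group_def)
  show "h \<in> hom (presented_group R) G"
    by (rule homI) (auto simp: h mult_word_class word_eval_append f)
qed

end

lemma word_class_letter:
  "word_class R [(a, b)] =
    (if b then word_class R [(a, True)] else inv\<^bsub>presented_group R\<^esub> word_class R [(a, True)])"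
proof -
  interpret group "presented_group R" by (rule group_presented_group)
  have "word_class R [(a, False)] \<otimes>\<^bsub>presented_group R\<^esub> word_class R [(a, True)]
      = \<one>\<^bsub>presented_group R\<^esub>"
    using word_eq.cancel[of R a False] unfolding mult_word_class
    by (simp add: presented_group_def word_class_eq_iff)
  then have "inv\<^bsub>presented_group R\<^esub> word_class R [(a, True)] = word_class R [(a, False)]"
    by (rule inv_equality) (simp_all add: presented_group_def)
  then show ?thesis by simp
qed

text \<open>Turns a class of words into a product of generators, so that the
  \<open>word_eval\<close> lemmas apply inside the presented group itself.\<close>

lemma word_class_eq_word_eval:
  "word_class R u = word_eval (presented_group R) (\<lambda>a. word_class R [(a, True)]) u"
proof (induction u)
  case Nil
  show ?case by (simp add: presented_group_def)
next
  case (Cons l u)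
  obtain a b where l: "l = (a, b)" by force
  have "word_class R (l # u) = word_class R [(a, b)] \<otimes>\<^bsub>presented_group R\<^esub> word_class R u"
    by (simp add: mult_word_class l)
  then show ?case
    using Cons.IH word_class_letter[of R a b] by (simp add: l)
qed

section \<open>Permutation, automorphism and affine groups\<close>

lemma carrier_BijGroup: "carrier (BijGroup S) = Bij S"
  and one_BijGroup: "\<one>\<^bsub>BijGroup S\<^esub> = (\<lambda>x\<in>S. x)"
  and mult_BijGroup: "f \<in> Bij S \<Longrightarrow> g \<in> Bij S \<Longrightarrow> f \<otimes>\<^bsub>BijGroup S\<^esub> g = compose S f g"
  by (simp_all add: BijGroup_def)

lemma carrier_AutoGroup: "carrier (AutoGroup G) = auto G"
  by (simp add: AutoGroup_def)

lemma mult_AutoGroup: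
  "\<alpha> \<in> auto G \<Longrightarrow> \<beta> \<in> auto G \<Longrightarrow> \<alpha> \<otimes>\<^bsub>AutoGroup G\<^esub> \<beta> = compose (carrier G) \<alpha> \<beta>"
  by (simp add: AutoGroup_def BijGroup_def auto_def)

text \<open>The pair \<open>(i, a)\<close> is the affine map \<open>v \<mapsto> r\<^sup>i v + a\<close>.\<close>

definition affine_group :: "rat \<Rightarrow> (int \<times> rat) monoid" where
  "affine_group r =
    \<lparr>carrier = UNIV, mult = \<lambda>(i, a) (j, b). (i + j, a + r powi i * b), one = (0, 0)\<rparr>"

lemma affine_group_simps [simp]:
  "carrier (affine_group r) = UNIV"
  "(i, a) \<otimes>\<^bsub>affine_group r\<^esub> (j, b) = (i + j, a + r powi i * b)"
  "\<one>\<^bsub>affine_group r\<^esub> = (0, 0)"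
  by (simp_all add: affine_group_def)

lemma group_affine_group:
  assumes "r \<noteq> 0"
  shows "group (affine_group r)"
proof (rule groupI)
  fix f assume "f \<in> carrier (affine_group r)"
  obtain i a where "f = (i, a)" by force
  \<comment> \<open>The inverse of \<open>v \<mapsto> r^i v + a\<close> is
    \<open>v \<mapsto> r^(-i) (v - a)\<close>.\<close>
  with assms have "(- i, - (r powi (- i) * a)) \<otimes>\<^bsub>affine_group r\<^esub> f = \<one>\<^bsub>affine_group r\<^esub>" by simp
  then show "\<exists>g\<in>carrier (affine_group r). g \<otimes>\<^bsub>affine_group r\<^esub> f = \<one>\<^bsub>affine_group r\<^esub>" by auto
qed (use assms in \<open>auto simp: power_int_add algebra_simps\<close>)

lemma affine_group_pow:
  assumes "r \<noteq> 0"
  shows "(0, a) [^]\<^bsub>affine_group r\<^esub> (k :: int) = (0, of_int k * a)"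
proof -
  interpret A: group "affine_group r" using assms by (rule group_affine_group)
  have nat: "(0, a) [^]\<^bsub>affine_group r\<^esub> j = (0, of_nat j * a)" for j :: nat
    by (induction j) (simp_all add: algebra_simps)
  have inv: "inv\<^bsub>affine_group r\<^esub> (0, b) = (0, - b)" for b
    by (rule A.inv_equality) simp_all
  show ?thesis
    using nat[of "nat k"] nat[of "nat (- k)"] A.int_pow_neg_int[of "(0, a)" "nat (- k)"] inv
    by (cases "k \<ge> 0") simp_all
qed

section \<open>Normal forms in Baumslag--Solitar groups\<close>

locale baumslag_solitar =
  fixes p q n :: int and G :: "bs_gen word set monoid" (structure)
  assumes p_gt_1: "p > 1" and q_eq: "q = p * n" and abs_n: "\<bar>n\<bar> > 1"
    and G_eq: "G = BS p q"
begin

abbreviation "rels \<equiv>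
  {(word_pow Gen_t 1 @ word_pow Gen_x p @ word_pow Gen_t (- 1), word_pow Gen_x q)}"

lemma G_presented: "G = presented_group rels"
  by (simp add: G_eq BS_def)

sublocale group G
  unfolding G_presented by (rule group_presented_group)

section \<open>Generators, universal property and induction over words\<close>

definition X :: "bs_gen word set" where "X = word_class rels [(Gen_x, True)]"
definition T :: "bs_gen word set" where "T = word_class rels [(Gen_t, True)]"

lemma X_closed [simp, intro]: "X \<in> carrier G" and T_closed [simp, intro]: "T \<in> carrier G"
  by (simp_all add: X_def T_def G_presented presented_group_def)

lemma word_class_gen: "word_class rels [(a, True)] = case_bs_gen X T a"
  by (cases a) (simp_all add: X_def T_def)

lemma word_eval_rels:
  assumes "group H" and "\<And>a. f a \<in> carrier H" and "(u, v) \<in> rels"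
    and "f Gen_t \<otimes>\<^bsub>H\<^esub> f Gen_x [^]\<^bsub>H\<^esub> p \<otimes>\<^bsub>H\<^esub> inv\<^bsub>H\<^esub> f Gen_t = f Gen_x [^]\<^bsub>H\<^esub> q"
  shows "word_eval H f u = word_eval H f v"
proof -
  interpret H: group H by fact
  show ?thesis
    using assms by (auto simp: H.word_eval_append H.word_eval_word_pow H.int_pow_neg H.m_assoc)
qed

lemma relation: "T \<otimes> X [^] p \<otimes> inv T = X [^] q"
proof -
  let ?f = "\<lambda>a. word_class rels [(a, True)]"
  have f: "?f a \<in> carrier G" for a by (simp add: G_presented presented_group_def)
  have "word_class rels (word_pow Gen_t 1 @ word_pow Gen_x p @ word_pow Gen_t (- 1))
      = word_class rels (word_pow Gen_x q)"
    by (simp add: word_class_eq_iff word_eq.rel)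
  then show ?thesis
    unfolding word_class_eq_word_eval[of _ "word_pow _ _"] word_class_eq_word_eval[of _ "_ @ _"]
      G_presented[symmetric]
    by (simp add: word_eval_append word_eval_word_pow f int_pow_neg m_assoc)
      (simp add: word_class_gen m_assoc)
qed

lemma lift:
  assumes "group H" and xy: "x \<in> carrier H" "t \<in> carrier H"
    and "t \<otimes>\<^bsub>H\<^esub> x [^]\<^bsub>H\<^esub> p \<otimes>\<^bsub>H\<^esub> inv\<^bsub>H\<^esub> t = x [^]\<^bsub>H\<^esub> q"
  obtains h where "h \<in> hom G H" and "h X = x" and "h T = t"
proof -
  interpret H: group H by fact
  have f: "case_bs_gen x t a \<in> carrier H" for a using xy by (cases a) auto
  obtain h where "h \<in> hom G H" "\<And>u. h (word_class rels u) = word_eval H (case_bs_gen x t) u"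
    using H.presented_group_lift[of "case_bs_gen x t" rels, OF f word_eval_rels[OF \<open>group H\<close> f]] assms(4)
    unfolding G_presented by auto
  then show ?thesis
    using xy by (intro that[of h]) (auto simp: X_def T_def)
qed

lemma induct_carrier [consumes 1, case_names one x x_inv t t_inv]:
  assumes "g \<in> carrier G" and "P \<one>"
    and "\<And>g. g \<in> carrier G \<Longrightarrow> P g \<Longrightarrow> P (X \<otimes> g)"
    and "\<And>g. g \<in> carrier G \<Longrightarrow> P g \<Longrightarrow> P (inv X \<otimes> g)"
    and "\<And>g. g \<in> carrier G \<Longrightarrow> P g \<Longrightarrow> P (T \<otimes> g)"
    and "\<And>g. g \<in> carrier G \<Longrightarrow> P g \<Longrightarrow> P (inv T \<otimes> g)"
  shows "P g"
proof -
  let ?f = "\<lambda>a. word_class rels [(a, True)]"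
  have f: "?f a \<in> carrier G" for a by (simp add: G_presented presented_group_def)
  obtain u where g: "g = word_class rels u"
    using assms(1) by (auto simp: G_presented presented_group_def)
  have "P (word_eval G ?f u)"
  proof (induction u)
    case (Cons l u)
    then show ?case
      using f assms(3-) by (cases l; cases "fst l"; cases "snd l") (auto simp: word_class_gen)
  qed (simp add: assms(2))
  then show ?thesis
    unfolding g word_class_eq_word_eval[of _ u] G_presented[symmetric] .
qed

lemma hom_eqI:
  assumes "group H" "h \<in> hom G H" "h' \<in> hom G H" "h X = h' X" "h T = h' T" "g \<in> carrier G"
  shows "h g = h' g"
proof -
  interpret h: group_hom G H h using assms by (intro group_hom.intro group_hom_axioms.intro group_axioms)
  interpret h': group_hom G H h' using assms by (intro group_hom.intro group_hom_axioms.intro group_axioms)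
  show ?thesis
    using \<open>g \<in> carrier G\<close> by (induction rule: induct_carrier) (simp_all add: assms)
qed

section \<open>The associated subgroups of the HNN extension\<close>

text \<open>\<open>G\<close> is an HNN extension of the powers of x with associated subgroups
  generated by x^p and x^q. \<open>modulus e\<close> is the exponent generating the one whose
  elements pass leftwards through \<open>stable_letter e\<close>, as \<open>stable_X_pow\<close>
  records.\<close>

definition modulus :: "bool \<Rightarrow> int" where "modulus e = (if e then p else q)"
definition stable_letter :: "bool \<Rightarrow> bs_gen word set" where "stable_letter e = (if e then T else inv T)"

lemma stable_closed [simp, intro]: "stable_letter e \<in> carrier G"
  by (simp add: stable_letter_def)

lemma stable_Not: "stable_letter (\<not> e) = inv stable_letter e"
  by (simp add: stable_letter_def)

lemma n_nonzero: "n \<noteq> 0"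
  using abs_n by auto

lemma modulus_nonzero [simp]: "modulus e \<noteq> 0"
  unfolding modulus_def using p_gt_1 n_nonzero q_eq by (cases e) auto

text \<open>Since \<open>p > 1\<close> divides both moduli, neither associated subgroup contains x.
  This is what later separates the residues of \<open>a\<close> and \<open>a + 1\<close>.\<close>

lemma modulus_not_unit: "\<not> modulus e dvd 1"
  unfolding modulus_def using p_gt_1 q_eq by (cases e) (auto simp: abs_mult zmult_eq_1_iff)

lemma X_pow_X_pow: "X [^] (i :: int) \<otimes> X [^] (j :: int) = X [^] (i + j)"
  by (simp add: int_pow_mult)

lemma conj_int_pow:
  assumes "g \<in> carrier G" "a \<in> carrier G"
  shows "(g \<otimes> a \<otimes> inv g) [^] (k :: int) = g \<otimes> a [^] k \<otimes> inv g"
proof -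
  have cancel: "inv g \<otimes> (g \<otimes> h) = h" if "h \<in> carrier G" for h
    using that assms by (simp add: m_assoc[symmetric])
  have "(\<lambda>a. g \<otimes> a \<otimes> inv g) \<in> hom G G"
    using assms by (intro homI) (auto simp: m_assoc cancel)
  from hom_int_pow[OF this assms(2) group_axioms group_axioms] show ?thesis by simp
qed

lemma stable_X_pow: "stable_letter e \<otimes> X [^] (modulus e * s) = X [^] (modulus (\<not> e) * s) \<otimes> stable_letter e"
proof -
  have "T \<otimes> X [^] (p * s) \<otimes> inv T = X [^] (q * s)"
    using conj_int_pow[of T "X [^] p" s] relation by (simp add: int_pow_pow)
  then have *: "T \<otimes> X [^] (p * s) = X [^] (q * s) \<otimes> T"
    by (simp add: inv_solve_right')
  have "X [^] (p * s) \<otimes> inv T = inv T \<otimes> (T \<otimes> X [^] (p * s)) \<otimes> inv T"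
    by (simp add: m_assoc[symmetric])
  also have "\<dots> = inv T \<otimes> X [^] (q * s)"
    unfolding * by (simp add: m_assoc)
  finally have "inv T \<otimes> X [^] (q * s) = X [^] (p * s) \<otimes> inv T" ..
  with * show ?thesis
    by (simp add: stable_letter_def modulus_def)
qed

section \<open>The left action on normal forms\<close>

text \<open>
  The group acts on normal_form forms \<open>x^m t^e\<^sub>1 x^a\<^sub>1 \<dots> t^e\<^sub>k x^a\<^sub>k\<close> from the left, as on its own elements.
  Such a form is encoded as \<open>(m, [(e\<^sub>1, a\<^sub>1), \<dots>, (e\<^sub>k, a\<^sub>k)])\<close> with \<open>True\<close> for exponent \<open>1\<close> of \<open>t\<close>.
  The residue \<open>a mod M\<close> is nonpositive if \<open>M < 0\<close>; only its uniqueness matters.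
\<close>

definition reduced :: "(bool \<times> int) list \<Rightarrow> bool" where
  "reduced = successively (\<lambda>(e, a) (e', _). \<not> (modulus e dvd a \<and> e' = (\<not> e)))"

definition normal_form :: "(bool \<times> int) list \<Rightarrow> bool" where
  "normal_form L \<longleftrightarrow> reduced L \<and> (\<forall>(e, a)\<in>set L. a mod modulus e = a)"

definition states :: "(int \<times> (bool \<times> int) list) set" where
  "states = UNIV \<times> Collect normal_form"

text \<open>Left multiplication by \<open>stable_letter e\<close>: write
  \<open>m = modulus e * s + r\<close>, move the multiple to the left of the letter and keep
  \<open>r\<close> behind it. If \<open>r = 0\<close> and the list starts with the opposite letter,
  the two letters cancel.\<close>

definition step :: "bool \<Rightarrow> int \<times> (bool \<times> int) list \<Rightarrow> int \<times> (bool \<times> int) list" where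
  "step e = (\<lambda>(m, L).
    if modulus e dvd m \<and> L \<noteq> [] \<and> fst (hd L) = (\<not> e)
    then (modulus (\<not> e) * (m div modulus e) + snd (hd L), tl L)
    else (modulus (\<not> e) * (m div modulus e), (e, m mod modulus e) # L))"

lemma reduced_Nil [simp]: "reduced []"
  by (simp add: reduced_def)

lemma reduced_Cons:
  "reduced ((e, a) # L) \<longleftrightarrow>
    L = [] \<or> \<not> (modulus e dvd a \<and> fst (hd L) = (\<not> e)) \<and> reduced L"
  by (auto simp: reduced_def successively_Cons case_prod_beta)

lemma reduced_append:
  "reduced (L @ L') \<longleftrightarrow> reduced L \<and> reduced L' \<and>
    (L = [] \<or> L' = [] \<or> \<not> (modulus (fst (last L)) dvd snd (last L) \<and> fst (hd L') = (\<not> fst (last L))))"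
  by (auto simp: reduced_def successively_append_iff case_prod_beta)

lemma mem_states [simp]: "(m, L) \<in> states \<longleftrightarrow> normal_form L"
  by (simp add: states_def)

lemma normal_Nil [simp]: "normal_form []"
  by (simp add: normal_form_def)

lemma step_closed: "\<sigma> \<in> states \<Longrightarrow> step e \<sigma> \<in> states"
  by (cases \<sigma>; cases "snd \<sigma>") (auto simp: normal_form_def step_def reduced_Cons dvd_mod_iff)

lemma add_residue:
  assumes "(M :: int) \<noteq> 0" "a mod M = a"
  shows "(M * s + a) div M = s" "(M * s + a) mod M = a" "M dvd M * s + a \<longleftrightarrow> a = 0"
proof -
  have "M * (a div M) = 0"
    using assms(2) mult_div_mod_eq[of M a] by linarith
  then have "a div M = 0" using assms(1) by simp
  with assms(1) show "(M * s + a) div M = s" by simp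
  show "(M * s + a) mod M = a" by (simp add: assms(2))
  show "M dvd M * s + a \<longleftrightarrow> a = 0" using assms(2) by (auto simp: dvd_eq_mod_eq_0)
qed

text \<open>The two branches of \<open>step\<close> undo each other. After a cancellation,
  reducedness of the old list rules out a second one on the way back, so the removed letter is put
  back with its residue; a letter just added is followed by residue-free exponent and
  cancels.\<close>

lemma step_step:
  assumes "\<sigma> \<in> states"
  shows "step (\<not> e) (step e \<sigma>) = \<sigma>"
proof (cases \<sigma>)
  case (Pair m L)
  show ?thesis
  proof (cases "modulus e dvd m \<and> L \<noteq> [] \<and> fst (hd L) = (\<not> e)")
    case True
    then obtain a L' where L: "L = (\<not> e, a) # L'"
      by (cases L; cases "hd L") auto
    have a: "a mod modulus (\<not> e) = a" and red: "reduced L"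
      using assms by (auto simp: Pair normal_form_def L)
    have "\<not> (a = 0 \<and> L' \<noteq> [] \<and> fst (hd L') = e)"
      using red by (auto simp: L reduced_Cons)
    then show ?thesis
      using True add_residue[OF _ a] by (auto simp: Pair L step_def)
  next
    case False
    then show ?thesis
      by (auto simp: Pair step_def)
  qed
qed

definition X_action :: "int \<times> (bool \<times> int) list \<Rightarrow> int \<times> (bool \<times> int) list" where
  "X_action = (\<lambda>(m, L)\<in>states. (m + 1, L))"

lemma X_action_Bij: "X_action \<in> Bij states"
proof -
  have "bij_betw X_action states states"
    by (rule bij_betw_byWitness[where f' = "\<lambda>(m, L). (m - 1, L)"])
      (auto simp: X_action_def)
  then show ?thesis by (simp add: Bij_def X_action_def)
qed

lemma step_Bij: "restrict (step e) states \<in> Bij states"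
proof -
  have "bij_betw (restrict (step e) states) states states"
    using step_step[of _ "\<not> e"]
    by (intro bij_betw_byWitness[where f' = "step (\<not> e)"]) (auto simp: step_step step_closed)
  then show ?thesis by (simp add: Bij_def)
qed

lemma X_action_pow:
  "X_action [^]\<^bsub>BijGroup states\<^esub> (k :: int) = (\<lambda>(m, L)\<in>states. (m + k, L))"
proof -
  interpret B: group "BijGroup states" by (rule group_BijGroup)
  have X: "X_action \<in> carrier (BijGroup states)" by (simp add: carrier_BijGroup X_action_Bij)
  have nat: "X_action [^]\<^bsub>BijGroup states\<^esub> j = (\<lambda>(m, L)\<in>states. (m + int j, L))" for j :: nat
  proof (induction j)
    case 0
    then show ?case by (auto simp: one_BijGroup fun_eq_iff restrict_def)
  next
    case (Suc j)
    have "X_action [^]\<^bsub>BijGroup states\<^esub> Suc j =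
        compose states (X_action [^]\<^bsub>BijGroup states\<^esub> j) X_action"
      using B.nat_pow_closed[OF X, of j]
      by (simp add: carrier_BijGroup mult_BijGroup X_action_Bij)
    then have "X_action [^]\<^bsub>BijGroup states\<^esub> Suc j =
        compose states (\<lambda>(m, L)\<in>states. (m + int j, L)) X_action"
      unfolding Suc .
    also have "\<dots> = (\<lambda>(m, L)\<in>states. (m + int (Suc j), L))"
      by (auto simp: X_action_def compose_def fun_eq_iff)
    finally show ?case .
  qed
  show ?thesis
  proof (cases "k \<ge> 0")
    case True
    then show ?thesis using nat[of "nat k"] by simp
  next
    case False
    let ?Y = "\<lambda>(m, L)\<in>states. (m + k, L)" and ?Z = "\<lambda>(m, L)\<in>states. (m + int (nat (- k)), L)"
    have Z: "?Z \<in> carrier (BijGroup states)"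
      using B.nat_pow_closed[OF X, of "nat (- k)"] nat by simp
    have "bij_betw ?Y states states"
      by (rule bij_betw_byWitness[where f' = "\<lambda>(m, L). (m - k, L)"]) auto
    then have Y: "?Y \<in> Bij states" by (simp add: Bij_def)
    have "?Y \<otimes>\<^bsub>BijGroup states\<^esub> ?Z = \<one>\<^bsub>BijGroup states\<^esub>"
      using Y Z False
      by (auto simp: carrier_BijGroup one_BijGroup mult_BijGroup compose_def fun_eq_iff)
    then have "inv\<^bsub>BijGroup states\<^esub> ?Z = ?Y"
      using Y Z by (intro B.inv_equality) (simp_all add: carrier_BijGroup)
    then show ?thesis using False B.int_pow_neg_int[OF X, of "nat (- k)"] by (simp add: nat)
  qed
qed

lemma action_exists:
  "\<exists>h. h \<in> hom G (BijGroup states) \<and> h X = X_action \<and> h T = restrict (step True) states"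
proof -
  interpret B: group "BijGroup states" by (rule group_BijGroup)
  let ?t = "restrict (step True) states"
  have c: "X_action \<in> carrier (BijGroup states)" "?t \<in> carrier (BijGroup states)"
    by (simp_all add: carrier_BijGroup X_action_Bij step_Bij del: restrict_apply)
  have pow: "(\<lambda>(m, L)\<in>states. (m + k, L)) \<in> Bij states" for k
    using B.int_pow_closed[OF c(1), of k] by (simp add: carrier_BijGroup X_action_pow)
  have "?t \<otimes>\<^bsub>BijGroup states\<^esub> X_action [^]\<^bsub>BijGroup states\<^esub> p
      = X_action [^]\<^bsub>BijGroup states\<^esub> q \<otimes>\<^bsub>BijGroup states\<^esub> ?t"
  proof -
    \<comment> \<open>Adding \<open>p\<close> raises the quotient by one and keeps the residue and
      the branch taken, so the resulting leading exponent grows by \<open>modulus False\<close>,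
      which is \<open>q\<close>.\<close>
    have "step True (m + p, L) = (case step True (m, L) of (m', L') \<Rightarrow> (m' + q, L'))" for m L
      using p_gt_1 div_add_self2[of p m] by (simp add: step_def modulus_def distrib_left del: div_add_self2)
    then have "compose states ?t (\<lambda>(m, L)\<in>states. (m + p, L))
        = compose states (\<lambda>(m, L)\<in>states. (m + q, L)) ?t"
      by (auto simp: compose_def fun_eq_iff step_closed split: prod.splits)
    then show ?thesis
      unfolding X_action_pow by (simp add: mult_BijGroup pow step_Bij)
  qed
  then have "?t \<otimes>\<^bsub>BijGroup states\<^esub> X_action [^]\<^bsub>BijGroup states\<^esub> p \<otimes>\<^bsub>BijGroup states\<^esub>
      inv\<^bsub>BijGroup states\<^esub> ?t = X_action [^]\<^bsub>BijGroup states\<^esub> q"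
    using c by (simp add: B.m_assoc)
  from lift[OF B.group_axioms c this] show ?thesis by metis
qed

definition action :: "bs_gen word set \<Rightarrow> int \<times> (bool \<times> int) list \<Rightarrow> int \<times> (bool \<times> int) list" where
  "action = (SOME h. h \<in> hom G (BijGroup states) \<and> h X = X_action \<and> h T = restrict (step True) states)"

lemma action: "action \<in> hom G (BijGroup states)" "action X = X_action"
    "action T = restrict (step True) states"
  using someI_ex[OF action_exists, folded action_def] by simp_all

lemma action_hom: "group_hom G (BijGroup states) action"
  by (intro group_hom.intro group_hom_axioms.intro group_axioms group_BijGroup action)

lemma action_Bij: "g \<in> carrier G \<Longrightarrow> action g \<in> Bij states"
  using group_hom.hom_closed[OF action_hom] by (simp add: carrier_BijGroup)

lemma action_closed [simp, intro]: "g \<in> carrier G \<Longrightarrow> \<sigma> \<in> states \<Longrightarrow> action g \<sigma> \<in> states"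
  using Bij_imp_funcset[OF action_Bij] by (rule funcset_mem)

lemma action_one [simp]: "\<sigma> \<in> states \<Longrightarrow> action \<one> \<sigma> = \<sigma>"
  using group_hom.hom_one[OF action_hom] by (simp add: one_BijGroup)

lemma action_mult [simp]:
  "g \<in> carrier G \<Longrightarrow> h \<in> carrier G \<Longrightarrow> \<sigma> \<in> states \<Longrightarrow> action (g \<otimes> h) \<sigma> = action g (action h \<sigma>)"
  using group_hom.hom_mult[OF action_hom] action_Bij by (simp add: mult_BijGroup compose_def)

lemma action_X_pow [simp]: "normal_form L \<Longrightarrow> action (X [^] (k :: int)) (m, L) = (m + k, L)"
  using group_hom.hom_int_pow[OF action_hom X_closed, of k] by (simp add: action X_action_pow)

lemma action_stable [simp]:
  assumes "\<sigma> \<in> states"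
  shows "action (stable_letter e) \<sigma> = step e \<sigma>"
proof -
  have "action T (step False \<sigma>) = \<sigma>"
    using step_step[OF assms, of False] by (simp add: action step_closed assms)
  then have "action (inv T) \<sigma> = step False \<sigma>"
    by (metis T_closed action_mult action_one assms inv_closed l_inv step_closed)
  then show ?thesis
    using assms by (simp add: stable_letter_def action)
qed

section \<open>Normal forms as group elements\<close>

fun elt :: "(bool \<times> int) list \<Rightarrow> bs_gen word set" where
  "elt [] = \<one>"
| "elt ((e, a) # L) = stable_letter e \<otimes> (X [^] a \<otimes> elt L)"

lemma elt_closed [simp, intro]: "elt L \<in> carrier G"
  by (induction L rule: elt.induct) auto

lemma elt_append: "elt (L @ L') = elt L \<otimes> elt L'"
  by (induction L rule: elt.induct) (auto simp: m_assoc)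

text \<open>A pinch in Britton's sense: a power from the associated subgroup passes the first
  letter, which then meets its inverse.\<close>

lemma stable_letter_pinch:
  "stable_letter e \<otimes> (X [^] (modulus e * s) \<otimes> (stable_letter (\<not> e) \<otimes> (X [^] a \<otimes> elt L)))
    = X [^] (modulus (\<not> e) * s + a) \<otimes> elt L"
proof -
  have "stable_letter e \<otimes> (X [^] (modulus e * s) \<otimes> (stable_letter (\<not> e) \<otimes> (X [^] a \<otimes> elt L)))
      = stable_letter e \<otimes> X [^] (modulus e * s) \<otimes> (stable_letter (\<not> e) \<otimes> (X [^] a \<otimes> elt L))"
    by (simp add: m_assoc)
  also have "\<dots> = X [^] (modulus (\<not> e) * s) \<otimes> (stable_letter e \<otimes> stable_letter (\<not> e)) \<otimes> (X [^] a \<otimes> elt L)"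
    unfolding stable_X_pow by (simp add: m_assoc)
  also have "\<dots> = X [^] (modulus (\<not> e) * s + a) \<otimes> elt L"
    by (simp add: stable_Not int_pow_mult m_assoc)
  finally show ?thesis .
qed

text \<open>\<open>step\<close> imitates this computation in \<open>G\<close>; iterating it over the
  letters of a word brings every element to normal form.\<close>

lemma stable_letter_step:
  "stable_letter e \<otimes> (X [^] m \<otimes> elt L) = (case step e (m, L) of (m', L') \<Rightarrow> X [^] m' \<otimes> elt L')"
proof (cases "modulus e dvd m \<and> L \<noteq> [] \<and> fst (hd L) = (\<not> e)")
  case True
  then obtain a L' where L: "L = (\<not> e, a) # L'"
    by (cases L; cases "hd L") auto
  from True have "modulus e * (m div modulus e) = m" by simp
  with stable_letter_pinch[of e "m div modulus e" a L'] show ?thesis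
    using True by (simp add: step_def L)
next
  case False
  have "X [^] m = X [^] (modulus e * (m div modulus e)) \<otimes> X [^] (m mod modulus e)"
    by (simp add: X_pow_X_pow)
  then have "stable_letter e \<otimes> (X [^] m \<otimes> elt L)
      = stable_letter e \<otimes> X [^] (modulus e * (m div modulus e)) \<otimes> (X [^] (m mod modulus e) \<otimes> elt L)"
    by (simp add: m_assoc)
  also have "\<dots> = X [^] (modulus (\<not> e) * (m div modulus e)) \<otimes> elt ((e, m mod modulus e) # L)"
    unfolding stable_X_pow by (simp add: m_assoc)
  finally show ?thesis
    using False by (auto simp: step_def)
qed

lemma exists_normal_form:
  assumes "g \<in> carrier G"
  shows "\<exists>m L. normal_form L \<and> g = X [^] (m :: int) \<otimes> elt L"
proof -
  have shift: "\<exists>m L. normal_form L \<and> X [^] k \<otimes> g = X [^] (m :: int) \<otimes> elt L"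
    if "\<exists>m L. normal_form L \<and> g = X [^] (m :: int) \<otimes> elt L" for k :: int and g
    using that by (metis X_closed elt_closed int_pow_closed int_pow_mult m_assoc)
  have letter: "\<exists>m L. normal_form L \<and> stable_letter e \<otimes> g = X [^] (m :: int) \<otimes> elt L"
    if g: "\<exists>m L. normal_form L \<and> g = X [^] (m :: int) \<otimes> elt L" for e g
  proof -
    from g obtain m L where L: "normal_form L" "g = X [^] (m :: int) \<otimes> elt L" by blast
    then have "step e (m, L) \<in> states" by (simp add: step_closed)
    then show ?thesis
      unfolding L(2) stable_letter_step by (cases "step e (m, L)") auto
  qed
  from assms show ?thesis
  proof (induction rule: induct_carrier)
    case one
    show ?case by (rule exI[of _ 0], rule exI[of _ "[]"]) simp
  next
    case (x g)
    then show ?case using shift[of g 1] by simp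
  next
    case (x_inv g)
    then show ?case using shift[of g "- 1"] by (simp add: int_pow_neg)
  next
    case (t g)
    then show ?case using letter[of g True] by (simp add: stable_letter_def)
  next
    case (t_inv g)
    then show ?case using letter[of g False] by (simp add: stable_letter_def)
  qed
qed

section \<open>Britton's lemma and the number of stable letters\<close>

text \<open>No cancellation occurs on a reduced list: if the tail starts with the letter opposite to
  \<open>e\<close>, its leading exponent \<open>m'\<close> is a multiple of
  \<open>modulus e\<close>, so \<open>m' + a\<close> is one only if \<open>a\<close> is, which
  reducedness excludes. The last letter acts first, so it alone absorbs \<open>m\<close> directly,
  into its residue.\<close>

lemma action_elt_reduced:
  assumes "reduced L" "L \<noteq> []"
  shows "\<exists>m' L'. action (elt L) (m, []) = (m', L') \<and> length L' = length L
    \<and> fst (hd L') = fst (hd L) \<and> modulus (\<not> fst (hd L)) dvd m'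
    \<and> last L' = (fst (last L), (snd (last L) + m) mod modulus (fst (last L)))"
  using assms
proof (induction L rule: elt.induct)
  case (2 e a L)
  show ?case
  proof (cases "L = []")
    case True
    then show ?thesis by (simp add: step_def add.commute)
  next
    case False
    then have red: "reduced L" "\<not> (modulus e dvd a \<and> fst (hd L) = (\<not> e))"
      using "2.prems" by (auto simp: reduced_Cons)
    obtain m' L' where L': "action (elt L) (m, []) = (m', L')" "length L' = length L"
      "fst (hd L') = fst (hd L)" "modulus (\<not> fst (hd L)) dvd m'"
      "last L' = (fst (last L), (snd (last L) + m) mod modulus (fst (last L)))"
      using "2.IH"[OF red(1) False] by blast
    have norm: "normal_form L'"
      using action_closed[of "elt L" "(m, [])"] by (simp add: L')
    have "L' \<noteq> []" using L'(2) False by auto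
    moreover have "\<not> (modulus e dvd m' + a \<and> fst (hd L') = (\<not> e))"
    proof
      assume "modulus e dvd m' + a \<and> fst (hd L') = (\<not> e)"
      with L'(3,4) have "fst (hd L) = (\<not> e)" "modulus e dvd m'" "modulus e dvd m' + a" by auto
      with red(2) show False by (simp add: dvd_add_right_iff)
    qed
    ultimately show ?thesis
      using L' False norm by (auto simp: step_def)
  qed
qed simp

text \<open>\<open>(0, [])\<close> is the normal form of the identity, so the action takes it to the
  normal form of \<open>g\<close>; its stable letters are counted.\<close>

definition len :: "bs_gen word set \<Rightarrow> nat" where
  "len g = length (snd (action g (0, [])))"

lemma len_reduced:
  assumes "reduced L"
  shows "len (X [^] (m :: int) \<otimes> elt L) = length L"
proof (cases "L = []")
  case False
  obtain m' L' where "action (elt L) (0, []) = (m', L')" "length L' = length L"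
    using action_elt_reduced[OF assms False, of 0] by blast
  moreover have "normal_form L'"
    using action_closed[of "elt L" "(0, [])"] calculation by simp
  ultimately show ?thesis by (simp add: len_def)
qed (simp add: len_def)

text \<open>Each stable letter lengthens the list by at most one, and powers of x leave it alone.
  Subadditivity of \<open>len\<close> follows.\<close>

lemma length_action:
  assumes "\<sigma> \<in> states"
  shows "length (snd (action (X [^] (m :: int) \<otimes> elt L) \<sigma>)) \<le> length L + length (snd \<sigma>)"
proof -
  have shift: "snd (action (X [^] (k :: int)) \<tau>) = snd \<tau>" if "\<tau> \<in> states" for \<tau> k
    using that by (cases \<tau>) simp
  have step_le: "length (snd (step e \<tau>)) \<le> Suc (length (snd \<tau>))" for e \<tau>
    by (cases \<tau>) (auto simp: step_def)
  have "length (snd (action (elt L) \<sigma>)) \<le> length L + length (snd \<sigma>)"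
  proof (induction L rule: elt.induct)
    case (2 e a L)
    have st: "action (elt L) \<sigma> \<in> states" using assms by simp
    then have "action (elt ((e, a) # L)) \<sigma> = step e (action (X [^] a) (action (elt L) \<sigma>))"
      using assms by simp
    also have "length (snd \<dots>) \<le> Suc (length (snd (action (elt L) \<sigma>)))"
      using step_le shift[OF st, of a] by metis
    finally show ?case using 2 by simp
  qed (simp add: assms)
  then show ?thesis
    using assms by (simp add: shift)
qed

lemma len_le_length: "len (X [^] (m :: int) \<otimes> elt L) \<le> length L"
  using length_action[of "(0, [])" m L] by (simp add: len_def)

lemma len_mult:
  assumes "g \<in> carrier G" "h \<in> carrier G"
  shows "len (g \<otimes> h) \<le> len g + len h"
proof -
  obtain m L where L: "normal_form L" "g = X [^] (m :: int) \<otimes> elt L"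
    using exists_normal_form[OF assms(1)] by blast
  then have "len g = length L"
    by (simp add: len_reduced normal_form_def)
  moreover have "len (g \<otimes> h) = length (snd (action g (action h (0, []))))"
    using assms by (simp add: len_def)
  ultimately show ?thesis
    using length_action[OF action_closed[OF assms(2)], of "(0, [])" m L] by (simp add: L len_def)
qed

section \<open>Conjugates of powers of x and cyclically reduced words\<close>

text \<open>If \<open>h\<close> contained a stable letter, a factor x on its right would shift the
  residue of the last letter by one, while a power of x on its left leaves that residue alone; the
  modulus would divide 1. The case \<open>M = 1\<close> computes the centralizer of x, and in
  general x is conjugate to no other power of itself.\<close>

lemma X_pow_conj_X:
  assumes h: "h \<in> carrier G" and eq: "X [^] (M :: int) \<otimes> h = h \<otimes> X"
  shows "\<exists>j::int. h = X [^] j"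
proof -
  obtain m L where L: "normal_form L" "h = X [^] (m :: int) \<otimes> elt L"
    using exists_normal_form[OF h] by blast
  have "L = []"
  proof (rule ccontr)
    assume ne: "L \<noteq> []"
    have red: "reduced L" using L by (simp add: normal_form_def)
    have last: "\<exists>m'' L'. action (X [^] (k :: int) \<otimes> elt L) (m', []) = (m'', L')
        \<and> snd (last L') = (snd (last L) + m') mod modulus (fst (last L))" for k m'
    proof -
      obtain m'' L' where L': "action (elt L) (m', []) = (m'', L')"
        "last L' = (fst (last L), (snd (last L) + m') mod modulus (fst (last L)))"
        using action_elt_reduced[OF red ne, of m'] by blast
      moreover have "normal_form L'"
        using action_closed[of "elt L" "(m', [])"] by (simp add: L'(1))
      ultimately show ?thesis by simp
    qed
    have "action (X [^] M \<otimes> h) (0, []) = action (X [^] (M + m) \<otimes> elt L) (0, [])"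
      by (simp add: L m_assoc[symmetric] X_pow_X_pow)
    moreover have "action (h \<otimes> X) (0, []) = action (X [^] m \<otimes> elt L) (1, [])"
      using action_X_pow[of "[]" 1 0] h by (simp add: L)
    ultimately have "(snd (last L) + 0) mod modulus (fst (last L)) = (snd (last L) + 1) mod modulus (fst (last L))"
      using last[of "M + m" 0] last[of m 1] eq by auto
    then have "modulus (fst (last L)) dvd 1"
      by (metis add_diff_cancel_left mod_eq_dvd_iff diff_zero mod_0 dvd_minus_iff minus_diff_eq)
    then show False using modulus_not_unit by blast
  qed
  then show ?thesis using L by auto
qed

text \<open>The third hypothesis excludes a pinch at the seam between two copies of
  \<open>L\<close>, so the j-fold repetition of \<open>L\<close> is again reduced. The induction
  carries the last letter along in order to check the seam.\<close>

lemma len_cyclically_reduced_pow: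
  assumes "reduced L" "L \<noteq> []"
    and "\<not> (modulus (fst (last L)) dvd snd (last L) \<and> fst (hd L) = (\<not> fst (last L)))"
  shows "len (elt L [^] (j :: nat)) = j * length L"
proof -
  have "\<exists>L'. elt L [^] j = elt L' \<and> reduced L' \<and> length L' = j * length L \<and> (L' \<noteq> [] \<longrightarrow> last L' = last L)"
  proof (induction j)
    case 0
    show ?case by (rule exI[of _ "[]"]) simp
  next
    case (Suc j)
    then obtain L' where "elt L [^] j = elt L'" "reduced L'" "length L' = j * length L"
      "L' \<noteq> [] \<longrightarrow> last L' = last L" by blast
    then show ?case
      using assms by (intro exI[of _ "L' @ L"]) (auto simp: elt_append reduced_append)
  qed
  then obtain L' where "elt L [^] j = elt L'" "reduced L'" "length L' = j * length L" by blast
  then show ?thesis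
    using len_reduced[of L' 0] by simp
qed

lemma inv_mult_cancel [simp]:
  assumes "g \<in> carrier G" "h \<in> carrier G"
  shows "inv g \<otimes> (g \<otimes> h) = h" "g \<otimes> (inv g \<otimes> h) = h"
  using assms by (simp_all add: m_assoc[symmetric])

lemma conj_eq_iff:
  assumes "d \<in> carrier G" "w \<in> carrier G" "c \<in> carrier G"
  shows "inv d \<otimes> w \<otimes> d = c \<longleftrightarrow> w = d \<otimes> c \<otimes> inv d"
  using assms by (auto simp: m_assoc)

lemma conj_conj:
  assumes "d \<in> carrier G" "e \<in> carrier G" "w \<in> carrier G"
  shows "inv (d \<otimes> e) \<otimes> w \<otimes> (d \<otimes> e) = inv e \<otimes> (inv d \<otimes> w \<otimes> d) \<otimes> e"
  using assms by (simp add: inv_mult_group m_assoc)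

text \<open>
  A conjugate \<open>c\<close> of \<open>w\<close> of minimal length is, up to a power of \<open>x\<close>, cyclically reduced, so
  \<open>len (c ^ j) = j * len c\<close>. This is incompatible with \<open>c ^ (p j)\<close> being conjugate, by an element not
  depending on \<open>j\<close>, to \<open>c ^ (p n\<^sup>2 j)\<close>, unless \<open>len c = 0\<close>. Conjugating twice makes the exponent positive.
\<close>

lemma conj_X_pow_if_pow_conj:
  assumes w: "w \<in> carrier G" and g: "g \<in> carrier G" and eq: "g \<otimes> w [^] p \<otimes> inv g = w [^] q"
  obtains d m where "d \<in> carrier G" "w = d \<otimes> X [^] (m :: int) \<otimes> inv d"
proof -
  define f where "f d = len (inv d \<otimes> w \<otimes> d)" for d
  obtain d where d: "d \<in> carrier G" and min: "\<And>d'. d' \<in> carrier G \<Longrightarrow> f d \<le> f d'"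
    using ex_has_least_nat[of "\<lambda>d. d \<in> carrier G" \<one> f] by auto
  define c where "c = inv d \<otimes> w \<otimes> d"
  have c: "c \<in> carrier G" using d w by (simp add: c_def)
  obtain m L where L: "normal_form L" "c = X [^] (m :: int) \<otimes> elt L"
    using exists_normal_form[OF c] by blast
  have red: "reduced L" using L by (simp add: normal_form_def)
  have fd: "f d = length L"
    using len_reduced[OF red] L by (simp add: f_def c_def[symmetric])
  have "L = []"
  proof (rule ccontr)
    assume "L \<noteq> []"
    then obtain L0 e a where L0: "L = L0 @ [(e, a)]" by (metis rev_exhaust prod.collapse)
    \<comment> \<open>Conjugation by x^m moves the leading power to the other end, where it merges
      with the last exponent.\<close>
    define L1 where "L1 = L0 @ [(e, a + m)]"
    have red1: "reduced L1"
      using red unfolding L0 L1_def by (auto simp: reduced_append reduced_Cons)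
    define d1 where "d1 = d \<otimes> X [^] m"
    have d1: "d1 \<in> carrier G" using d by (simp add: d1_def)
    have c1: "inv d1 \<otimes> w \<otimes> d1 = elt L1"
    proof -
      have "inv d1 \<otimes> w \<otimes> d1 = inv (X [^] m) \<otimes> c \<otimes> X [^] m"
        using d w by (simp add: d1_def conj_conj c_def)
      also have "\<dots> = elt L \<otimes> X [^] m"
        by (simp add: L m_assoc[symmetric])
      also have "\<dots> = elt L1"
        by (simp add: L0 L1_def elt_append m_assoc X_pow_X_pow)
      finally show ?thesis .
    qed
    have cyc: "\<not> (modulus e dvd a + m \<and> fst (hd L1) = (\<not> e))"
    proof
      assume *: "modulus e dvd a + m \<and> fst (hd L1) = (\<not> e)"
      then obtain s where s: "a + m = modulus e * s" by auto
      have "L0 \<noteq> []" using * by (auto simp: L1_def)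
      then obtain b L2 where L2: "L0 = (\<not> e, b) # L2"
        using * by (cases L0; cases "hd L0") (auto simp: L1_def)
      \<comment> \<open>A pinch at the seam would allow rotating the last syllable \<open>?s\<close>
        to the front and cancelling it against the first letter. That conjugate has at least two
        letters fewer, contrary to the choice of \<open>d\<close>.\<close>
      let ?s = "stable_letter e \<otimes> X [^] (a + m)"
      have "inv (d1 \<otimes> inv ?s) \<otimes> w \<otimes> (d1 \<otimes> inv ?s) = ?s \<otimes> elt L1 \<otimes> inv ?s"
        using d1 w by (simp add: conj_conj c1)
      also have "elt L1 = elt L0 \<otimes> ?s"
        by (simp add: L1_def elt_append)
      also have "?s \<otimes> (elt L0 \<otimes> ?s) \<otimes> inv ?s = ?s \<otimes> elt L0"
        by (simp add: m_assoc)
      also have "\<dots> = X [^] (modulus (\<not> e) * s + b) \<otimes> elt L2"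
        using stable_letter_pinch[of e s b L2] by (simp add: L2 s m_assoc)
      finally have "f (d1 \<otimes> inv ?s) \<le> length L2"
        by (simp add: f_def len_le_length)
      moreover have "f d \<le> f (d1 \<otimes> inv ?s)"
        using d1 by (intro min) auto
      ultimately show False by (simp add: fd L0 L2)
    qed
    have len_pow: "len (elt L1 [^] (j :: nat)) = j * length L1" for j
      using red1 cyc by (intro len_cyclically_reduced_pow) (auto simp: L1_def)
    define c1 where "c1 = elt L1"
    have c1c: "c1 \<in> carrier G" by (simp add: c1_def)
    have wc1: "w = d1 \<otimes> c1 \<otimes> inv d1"
      using c1 d1 w by (simp add: c1_def conj_eq_iff)
    define g1 where "g1 = inv d1 \<otimes> g \<otimes> d1"
    have g1: "g1 \<in> carrier G" using d1 g by (simp add: g1_def)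
    have conj1: "g1 \<otimes> c1 [^] p \<otimes> inv g1 = c1 [^] q"
    proof -
      have "d1 \<otimes> (g1 \<otimes> c1 [^] p \<otimes> inv g1) \<otimes> inv d1 = g \<otimes> (d1 \<otimes> c1 [^] p \<otimes> inv d1) \<otimes> inv g"
        using d1 g c1c by (simp add: g1_def m_assoc inv_mult_group)
      also have "\<dots> = d1 \<otimes> c1 [^] q \<otimes> inv d1"
        using eq d1 c1c by (simp add: wc1 conj_int_pow)
      finally show ?thesis
        using d1 g1 c1c by simp
    qed
    have "g1 \<otimes> g1 \<otimes> c1 [^] p \<otimes> inv (g1 \<otimes> g1) = g1 \<otimes> c1 [^] q \<otimes> inv g1"
      using g1 c1c by (simp add: conj1[symmetric] m_assoc inv_mult_group)
    also have "\<dots> = (g1 \<otimes> c1 [^] p \<otimes> inv g1) [^] n"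
      using g1 c1c by (simp add: conj_int_pow int_pow_pow q_eq)
    also have "\<dots> = c1 [^] (p * n\<^sup>2)"
      using c1c by (simp add: conj1 int_pow_pow q_eq power2_eq_square mult.assoc)
    finally have conj2: "g1 \<otimes> g1 \<otimes> c1 [^] p \<otimes> inv (g1 \<otimes> g1) = c1 [^] (p * n\<^sup>2)" .
    define P N where "P = nat p" and "N = nat (n\<^sup>2)"
    have PN: "int P = p" "int N = n\<^sup>2" using p_gt_1 by (simp_all add: P_def N_def)
    have "\<bar>n\<bar> * \<bar>n\<bar> \<ge> 2 * 2" using abs_n by (intro mult_mono) auto
    then have "n\<^sup>2 \<ge> 4" by (simp add: power2_eq_square)
    then have "N \<ge> 4" using PN by linarith
    \<comment> \<open>The length cost of the conjugation by \<open>g1 \<otimes> g1\<close>, the same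
      for every \<open>j\<close>.\<close>
    define C where "C = len (g1 \<otimes> g1) + len (inv (g1 \<otimes> g1))"
    have bound: "P * N * j * length L1 \<le> C + P * j * length L1" for j :: nat
    proof -
      have "c1 [^] (P * N * j) = c1 [^] (int P * int N * int j)"
        using int_pow_int[of G c1 "P * N * j"] by (simp add: mult.assoc)
      also have "\<dots> = (c1 [^] (p * n\<^sup>2)) [^] int j"
        using c1c by (simp add: int_pow_pow PN)
      also have "\<dots> = g1 \<otimes> g1 \<otimes> (c1 [^] p) [^] int j \<otimes> inv (g1 \<otimes> g1)"
        using g1 c1c by (simp add: conj2[symmetric] conj_int_pow)
      also have "(c1 [^] p) [^] int j = c1 [^] (P * j)"
        using int_pow_int[of G c1 "P * j"] c1c by (simp add: int_pow_pow PN)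
      finally have "len (c1 [^] (P * N * j)) \<le> len (g1 \<otimes> g1 \<otimes> c1 [^] (P * j)) + len (inv (g1 \<otimes> g1))"
        using g1 c1c by (simp add: len_mult)
      also have "\<dots> \<le> len (g1 \<otimes> g1) + len (c1 [^] (P * j)) + len (inv (g1 \<otimes> g1))"
        using g1 c1c by (simp add: len_mult)
      finally show ?thesis by (simp add: len_pow c1_def C_def)
    qed
    \<comment> \<open>The bound at \<open>j = Suc C\<close> reads \<open>N * A \<le> C + A\<close>,
      which is impossible for \<open>A > C\<close> and \<open>N \<ge> 4\<close>.\<close>
    define A where "A = P * Suc C * length L1"
    have "P > 0" "length L1 > 0" using p_gt_1 by (simp_all add: P_def L1_def)
    then have "Suc C * 1 \<le> Suc C * (P * length L1)" by (intro mult_le_mono2) (simp add: Suc_le_eq)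
    then have "A > C" by (simp add: A_def algebra_simps)
    moreover have "4 * A \<le> N * A" using \<open>N \<ge> 4\<close> by simp
    moreover have "N * A \<le> C + A"
      using bound[of "Suc C"] by (simp add: A_def ac_simps del: mult_Suc mult_Suc_right)
    ultimately show False by linarith
  qed
  then have "inv d \<otimes> w \<otimes> d = X [^] m" using L by (simp add: c_def)
  then have "w = d \<otimes> X [^] m \<otimes> inv d"
    using d w by (simp add: conj_eq_iff)
  with d show ?thesis by (rule that)
qed

section \<open>Automorphisms of Baumslag--Solitar groups\<close>

text \<open>Conjugating by \<open>v \<mapsto> n v\<close> multiplies translations by
  \<open>n\<close>, so it takes the translation by \<open>p\<close> to the one by
  \<open>q\<close>.\<close>

lemma proj_exists: "\<exists>h. h \<in> hom G (affine_group (of_int n)) \<and> h X = (0, 1) \<and> h T = (1, 0)"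
proof -
  have n: "(of_int n :: rat) \<noteq> 0" using n_nonzero by simp
  interpret A: group "affine_group (of_int n)" using n by (rule group_affine_group)
  have "(1, 0) \<otimes>\<^bsub>affine_group (of_int n)\<^esub> (0, 1) [^]\<^bsub>affine_group (of_int n)\<^esub> p
      = (0, 1) [^]\<^bsub>affine_group (of_int n)\<^esub> q \<otimes>\<^bsub>affine_group (of_int n)\<^esub> (1, 0)"
    using n by (simp add: affine_group_pow q_eq)
  then have "(1, 0) \<otimes>\<^bsub>affine_group (of_int n)\<^esub> (0, 1) [^]\<^bsub>affine_group (of_int n)\<^esub> p
      \<otimes>\<^bsub>affine_group (of_int n)\<^esub> inv\<^bsub>affine_group (of_int n)\<^esub> (1, 0) = (0, 1) [^]\<^bsub>affine_group (of_int n)\<^esub> q"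
    by (simp only: A.m_assoc A.r_inv A.r_one affine_group_simps(1) UNIV_I A.inv_closed)
  from lift[OF A.group_axioms _ _ this] show ?thesis by (metis UNIV_I affine_group_simps(1))
qed

definition proj :: "bs_gen word set \<Rightarrow> int \<times> rat" where
  "proj = (SOME h. h \<in> hom G (affine_group (of_int n)) \<and> h X = (0, 1) \<and> h T = (1, 0))"

text \<open>\<open>expt\<close> is the exponent sum of t, and \<open>off\<close> is the translation
  part of the affine map.\<close>

definition expt :: "bs_gen word set \<Rightarrow> int" where "expt g = fst (proj g)"
definition off :: "bs_gen word set \<Rightarrow> rat" where "off g = snd (proj g)"

lemma proj: "proj \<in> hom G (affine_group (of_int n))" "proj X = (0, 1)" "proj T = (1, 0)"
  using someI_ex[OF proj_exists, folded proj_def] by simp_all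

lemma proj_hom: "group_hom G (affine_group (of_int n)) proj"
  using n_nonzero proj by (intro group_hom.intro group_hom_axioms.intro group_axioms group_affine_group) auto

lemma expt_off_gens [simp]: "expt X = 0" "off X = 1" "expt T = 1" "off T = 0"
  by (simp_all add: expt_def off_def proj)

lemma expt_off_one [simp]: "expt \<one> = 0" "off \<one> = 0"
  using group_hom.hom_one[OF proj_hom] by (simp_all add: expt_def off_def)

lemma expt_off_mult [simp]:
  assumes "g \<in> carrier G" "h \<in> carrier G"
  shows "expt (g \<otimes> h) = expt g + expt h" "off (g \<otimes> h) = off g + of_int n powi expt g * off h"
  using group_hom.hom_mult[OF proj_hom assms] by (cases "proj g"; cases "proj h"; simp add: expt_def off_def)+

lemma expt_off_inv [simp]:
  assumes "g \<in> carrier G"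
  shows "expt (inv g) = - expt g" "off (inv g) = - (of_int n powi (- expt g) * off g)"
proof -
  show expt: "expt (inv g) = - expt g"
    using expt_off_mult(1)[of "inv g" g] assms by simp
  show "off (inv g) = - (of_int n powi (- expt g) * off g)"
    using expt_off_mult(2)[of "inv g" g] assms by (simp add: expt eq_neg_iff_add_eq_0)
qed

lemma expt_off_X_pow [simp]: "expt (X [^] (k :: int)) = 0" "off (X [^] (k :: int)) = of_int k"
  using group_hom.hom_int_pow[OF proj_hom X_closed, of k] n_nonzero
  by (simp_all add: expt_def off_def proj affine_group_pow)

lemma X_pow_eq_iff: "X [^] (i :: int) = X [^] (j :: int) \<longleftrightarrow> i = j"
  by (metis expt_off_X_pow(2) of_int_eq_iff)

text \<open>As \<open>\<bar>n\<bar> > 1\<close>, only the zeroth natural power of \<open>n\<close>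
  is 1. Looking at both \<open>k - 1\<close> and \<open>1 - k\<close> provides a natural exponent
  for either sign.\<close>

lemma powi_eq_self:
  assumes "(of_int n :: rat) powi k = of_int n"
  shows "k = 1"
proof -
  have n: "(of_int n :: rat) \<noteq> 0" using n_nonzero by simp
  have big: "m = 0" if "(of_int n :: rat) ^ m = 1" for m
  proof (rule ccontr)
    assume "m \<noteq> 0"
    from that have "\<bar>n\<bar> ^ m = 1" by (metis of_int_eq_1_iff of_int_power power_abs abs_1)
    moreover have "1 < \<bar>n\<bar> ^ m" using abs_n \<open>m \<noteq> 0\<close> by (simp add: one_less_power)
    ultimately show False by simp
  qed
  have "(of_int n :: rat) powi (k - 1) = 1"
    using assms n by (simp add: power_int_diff)
  moreover have "(of_int n :: rat) powi (1 - k) = 1"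
    using assms n by (simp add: power_int_diff)
  ultimately have "(of_int n :: rat) ^ nat (k - 1) = 1 \<or> (of_int n :: rat) ^ nat (1 - k) = 1" "k \<ge> 1 \<or> 1 \<ge> k"
    by (auto simp: power_int_def split: if_splits)
  with \<open>_ powi (k - 1) = 1\<close> \<open>_ powi (1 - k) = 1\<close> show ?thesis
    using big[of "nat (k - 1)"] big[of "nat (1 - k)"] by (auto simp: power_int_def split: if_splits)
qed

text \<open>Membership of \<open>b\<close> in \<open>n^(-K) \<int>\<close>.\<close>

definition denom_bound :: "nat \<Rightarrow> rat \<Rightarrow> bool" where
  "denom_bound K b \<longleftrightarrow> b * of_int n ^ K \<in> \<int>"

lemma denom_bound_mono:
  assumes "denom_bound K b" "K \<le> K'"
  shows "denom_bound K' b"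
proof -
  have "(of_int n :: rat) ^ K' = of_int n ^ K * of_int n ^ (K' - K)"
    using assms(2) by (simp flip: power_add)
  then have "b * of_int n ^ K' = b * of_int n ^ K * of_int n ^ (K' - K)"
    by simp
  moreover have "\<dots> \<in> \<int>"
    using assms(1) unfolding denom_bound_def by (rule Ints_mult) simp
  ultimately show ?thesis by (simp only: denom_bound_def)
qed

lemma denom_bound_add: "denom_bound K a \<Longrightarrow> denom_bound K b \<Longrightarrow> denom_bound K (a + b)"
  and denom_bound_mult: "denom_bound K b \<Longrightarrow> c \<in> \<int> \<Longrightarrow> denom_bound K (c * b)"
  and denom_bound_Ints: "c \<in> \<int> \<Longrightarrow> denom_bound K c"
  by (simp_all add: denom_bound_def distrib_right mult.assoc)

text \<open>Among the letters only the inverse of t, which divides by \<open>n\<close>, can require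
  a larger power of \<open>n\<close> in the denominator.\<close>

lemma exists_denom_bound:
  assumes "g \<in> carrier G"
  shows "\<exists>K. denom_bound K (off g)"
  using assms
proof (induction rule: induct_carrier)
  case one
  show ?case by (simp add: denom_bound_def)
next
  case (x g)
  then obtain K where "denom_bound K (off g)" by blast
  then have "denom_bound K (off (X \<otimes> g))"
    using x denom_bound_add[OF denom_bound_Ints[of 1]] by simp
  then show ?case ..
next
  case (x_inv g)
  then obtain K where "denom_bound K (off g)" by blast
  then have "denom_bound K (off (inv X \<otimes> g))"
    using x_inv denom_bound_add[OF _ denom_bound_Ints[of "- 1"]] by simp
  then show ?case ..
next
  case (t g)
  then obtain K where "denom_bound K (off g)" by blast
  then have "denom_bound K (off (T \<otimes> g))"
    using t denom_bound_mult by simp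
  then show ?case ..
next
  case (t_inv g)
  then obtain K where "denom_bound K (off g)" by blast
  then have "denom_bound (Suc K) (off (inv T \<otimes> g))"
    using t_inv n_nonzero by (simp add: denom_bound_def power_int_minus field_simps)
  then show ?case ..
qed

section \<open>Translation parts of automorphisms\<close>

definition normalizes :: "bs_gen word set \<Rightarrow> int \<Rightarrow> (bs_gen word set \<Rightarrow> bs_gen word set) \<Rightarrow> bool" where
  "normalizes g e \<alpha> \<longleftrightarrow> g \<in> carrier G \<and> \<bar>e\<bar> = 1 \<and> \<alpha> \<in> hom G G \<and> \<alpha> X = g \<otimes> X [^] e \<otimes> inv g"

text \<open>Following \<alpha> by conjugation with the inverse of \<open>g\<close> yields a map with
  x going to x^e; \<open>shift\<close> is the translation part of the image of t under it.\<close>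

definition shift :: "bs_gen word set \<Rightarrow> (bs_gen word set \<Rightarrow> bs_gen word set) \<Rightarrow> rat" where
  "shift g \<alpha> = off (inv g \<otimes> \<alpha> T \<otimes> g)"

lemma group_homI: "\<alpha> \<in> hom G G \<Longrightarrow> group_hom G G \<alpha>"
  by (intro group_hom.intro group_hom_axioms.intro group_axioms)

text \<open>
  An endomorphism with \<open>x \<mapsto> x\<^sup>\<plusminus>\<^sup>1\<close> induces on the affine group the conjugation by an affine map,
  which has multiplier \<open>\<plusminus>1\<close> and value \<open>\<kappa>\<close> at \<open>0\<close>.
\<close>

lemma off_normalized:
  assumes h: "h \<in> hom G G" and X: "h X = X [^] e" and e: "\<bar>e\<bar> = 1" and w: "w \<in> carrier G"
  shows "expt (h w) = expt w" and "expt w = 1 \<Longrightarrow> off (h w) = of_int e * off w + off (h T)"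
proof -
  interpret h: group_hom G G h using h by (rule group_homI)
  have n: "(of_int n :: rat) \<noteq> 0" using n_nonzero by simp
  have "h T \<otimes> (h X) [^] p = (h X) [^] q \<otimes> h T"
    using stable_X_pow[of True 1]
    by (metis (no_types, lifting) T_closed X_closed h.hom_int_pow h.hom_mult int_pow_closed modulus_def mult.right_neutral stable_letter_def)
  \<comment> \<open>Comparing translation parts in the image of the relation shows that
    \<open>n powi expt (h T)\<close> equals \<open>n\<close>.\<close>
  then have "off (h T \<otimes> X [^] (e * p)) = off (X [^] (e * q) \<otimes> h T)"
    by (simp add: X int_pow_pow)
  then have "of_int n powi expt (h T) * (of_int e * of_int p) = of_int e * (of_int q :: rat)"
    unfolding expt_off_mult[OF h.hom_closed[OF T_closed] int_pow_closed[OF X_closed]]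
      expt_off_mult[OF int_pow_closed[OF X_closed] h.hom_closed[OF T_closed]] expt_off_X_pow of_int_mult
      power_int_0_right mult_1 by linarith
  then have "of_int n powi expt (h T) * (of_int e * of_int p) = of_int n * (of_int e * of_int p :: rat)"
    unfolding q_eq by (simp only: of_int_mult ac_simps)
  moreover have "(of_int e * of_int p :: rat) \<noteq> 0" using e p_gt_1 by auto
  ultimately have "expt (h T) = 1"
    by (intro powi_eq_self) (metis mult_right_cancel)
  have n1: "(1 - of_int n :: rat) \<noteq> 0" using abs_n by auto
  \<comment> \<open>The fixed point of \<open>v \<mapsto> n v + off (h T)\<close>, which is the
    image of the fixed point 0 of \<open>v \<mapsto> n v\<close>.\<close>
  define \<kappa> where "\<kappa> = off (h T) / (1 - of_int n)"
  have \<kappa>: "off (h T) = \<kappa> * (1 - of_int n)" using n1 by (simp add: \<kappa>_def)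
  have "expt (h w) = expt w \<and> off (h w) = of_int e * off w + \<kappa> * (1 - of_int n powi expt w)"
    using w
  proof (induction rule: induct_carrier)
    case (t_inv g)
    then show ?case
      using n by (simp add: \<open>expt (h T) = 1\<close> \<kappa> power_int_minus power_int_diff field_simps)
  next
    case (t g)
    then have "off (h (T \<otimes> g)) =
        \<kappa> * (1 - of_int n) + of_int n * (of_int e * off g + \<kappa> * (1 - of_int n powi expt g))"
      by (simp add: \<open>expt (h T) = 1\<close> \<kappa>)
    also have "\<dots> = of_int e * off (T \<otimes> g) + \<kappa> * (1 - of_int n powi expt (T \<otimes> g))"
      using t(1) n by (simp add: power_int_add algebra_simps)
    finally show ?case
      using t by (simp add: \<open>expt (h T) = 1\<close>)
  qed (simp_all add: X distrib_left right_diff_distrib)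
  then show "expt (h w) = expt w" and "expt w = 1 \<Longrightarrow> off (h w) = of_int e * off w + off (h T)"
    by (simp_all add: \<kappa>)
qed

lemma conj_hom:
  assumes "g \<in> carrier G" "\<alpha> \<in> hom G G"
  shows "(\<lambda>w. inv g \<otimes> \<alpha> w \<otimes> g) \<in> hom G G"
proof -
  interpret group_hom G G \<alpha> using assms(2) by (rule group_homI)
  show ?thesis using assms(1) by (intro homI) (simp_all add: m_assoc)
qed

lemma expt_normalizes:
  assumes "normalizes g e \<alpha>"
  shows "expt (inv g \<otimes> \<alpha> T \<otimes> g) = 1"
proof -
  interpret group_hom G G \<alpha> using assms by (simp add: normalizes_def group_homI)
  show ?thesis
    using off_normalized(1)[OF conj_hom, of g \<alpha> e T] assms
    by (simp add: normalizes_def conj_eq_iff m_assoc)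
qed

text \<open>Applying \<alpha> to \<open>h \<otimes> X [^] f \<otimes> inv h\<close> gives the
  conjugator \<open>\<alpha> h \<otimes> g\<close>. Conjugating back by it applies the normalized
  form of \<alpha> to \<open>inv h \<otimes> \<beta> T \<otimes> h\<close>, of exponent sum 1;
  \<open>off_normalized\<close> then gives the sum, the sign \<open>e\<close> coming from x going to
  x^e.\<close>

lemma normalizes_comp:
  assumes \<alpha>: "normalizes g e \<alpha>" and \<beta>: "normalizes h f \<beta>"
  shows "normalizes (\<alpha> h \<otimes> g) (e * f) (compose (carrier G) \<alpha> \<beta>)"
    and "shift (\<alpha> h \<otimes> g) (compose (carrier G) \<alpha> \<beta>) = of_int e * shift h \<beta> + shift g \<alpha>"
proof -
  interpret a: group_hom G G \<alpha> using \<alpha> by (simp add: normalizes_def group_homI)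
  interpret b: group_hom G G \<beta> using \<beta> by (simp add: normalizes_def group_homI)
  have g: "g \<in> carrier G" and h: "h \<in> carrier G" using \<alpha> \<beta> by (simp_all add: normalizes_def)
  have "\<alpha> (\<beta> X) = \<alpha> h \<otimes> (g \<otimes> X [^] e \<otimes> inv g) [^] f \<otimes> inv (\<alpha> h)"
    using \<alpha> \<beta> h by (simp add: normalizes_def a.hom_int_pow)
  also have "\<dots> = (\<alpha> h \<otimes> g) \<otimes> X [^] (e * f) \<otimes> inv (\<alpha> h \<otimes> g)"
    using g h by (simp add: conj_int_pow int_pow_pow) (simp add: inv_mult_group m_assoc)
  finally show "normalizes (\<alpha> h \<otimes> g) (e * f) (compose (carrier G) \<alpha> \<beta>)"
    using \<alpha> \<beta> g h hom_compose[of \<beta> G \<alpha> G] by (auto simp: normalizes_def abs_mult compose_eq)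
  define \<alpha>' where "\<alpha>' w = inv g \<otimes> \<alpha> w \<otimes> g" for w
  let ?w = "inv h \<otimes> \<beta> T \<otimes> h"
  have "shift (\<alpha> h \<otimes> g) (compose (carrier G) \<alpha> \<beta>) = off (\<alpha>' ?w)"
    using g h by (simp add: shift_def compose_def \<alpha>'_def inv_mult_group m_assoc)
  also have "\<dots> = of_int e * off ?w + off (\<alpha>' T)"
  proof (rule off_normalized(2))
    show "\<alpha>' \<in> hom G G" unfolding \<alpha>'_def using \<alpha> by (intro conj_hom) (simp_all add: normalizes_def)
    show "\<alpha>' X = X [^] e" using \<alpha> g by (simp add: \<alpha>'_def normalizes_def conj_eq_iff m_assoc)
    show "expt ?w = 1" using \<beta> by (rule expt_normalizes)
  qed (use \<alpha> h in \<open>simp_all add: normalizes_def\<close>)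
  finally show "shift (\<alpha> h \<otimes> g) (compose (carrier G) \<alpha> \<beta>) = of_int e * shift h \<beta> + shift g \<alpha>"
    by (simp add: shift_def \<alpha>'_def)
qed

text \<open>The quotient \<open>k\<close> of the two conjugators takes x to a power of x, so it is
  some x^j by \<open>X_pow_conj_X\<close>. Conjugation by x^j changes the translation part by the
  integer \<open>n * j - j\<close>.\<close>

lemma shift_diff_Ints:
  assumes g: "normalizes g e \<alpha>" and h: "normalizes h f \<alpha>"
  shows "shift h \<alpha> - shift g \<alpha> \<in> \<int>"
proof -
  interpret group_hom G G \<alpha> using g by (simp add: normalizes_def group_homI)
  have gc: "g \<in> carrier G" and hc: "h \<in> carrier G" and ff: "f * f = 1"
    using g h by (auto simp: normalizes_def abs_if split: if_splits)
  define k where "k = inv g \<otimes> h"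
  have k: "k \<in> carrier G" "h = g \<otimes> k" using gc hc by (simp_all add: k_def)
  have "g \<otimes> X [^] e \<otimes> inv g = h \<otimes> X [^] f \<otimes> inv h"
    using g h by (simp add: normalizes_def)
  then have "g \<otimes> (k \<otimes> X [^] f \<otimes> inv k) \<otimes> inv g = g \<otimes> X [^] e \<otimes> inv g"
    using gc k by (simp add: inv_mult_group m_assoc)
  then have "k \<otimes> X [^] f \<otimes> inv k = X [^] e"
    using gc k by simp
  then have "k \<otimes> X [^] (f * f) \<otimes> inv k = X [^] (e * f)"
    using k by (metis X_closed conj_int_pow int_pow_closed int_pow_pow)
  then have "X [^] (e * f) \<otimes> k = k \<otimes> X"
    using k by (simp add: ff inv_solve_right')
  then obtain j :: int where j: "k = X [^] j"
    using X_pow_conj_X[OF k(1)] by blast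
  define t where "t = inv g \<otimes> \<alpha> T \<otimes> g"
  have t: "t \<in> carrier G" "expt t = 1"
    using gc expt_normalizes[OF g] by (simp_all add: t_def)
  have "shift h \<alpha> = off (inv k \<otimes> t \<otimes> k)"
    using gc k by (simp add: shift_def t_def inv_mult_group m_assoc)
  also have "\<dots> = off t + of_int (n * j - j)"
    using t by (simp add: j)
  finally show ?thesis by (simp add: shift_def t_def)
qed

lemma auto_group_hom: "\<alpha> \<in> auto G \<Longrightarrow> group_hom G G \<alpha>"
  by (simp add: auto_def group_homI)

text \<open>Both \<alpha> and its inverse take x to conjugates of powers x^m and x^m'. Composing
  them makes x conjugate to its own power with exponent \<open>m * m'\<close>, which must therefore
  be 1.\<close>

lemma auto_normalizes:
  assumes "\<alpha> \<in> auto G"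
  shows "\<exists>g e. normalizes g e \<alpha>"
proof -
  interpret A: group "AutoGroup G" by (rule AutoGroup)
  have conj: "\<exists>d\<in>carrier G. \<exists>m::int. \<gamma> X = d \<otimes> X [^] m \<otimes> inv d" if "\<gamma> \<in> auto G" for \<gamma>
  proof -
    interpret c: group_hom G G \<gamma> using that by (rule auto_group_hom)
    have "\<gamma> T \<otimes> \<gamma> X [^] p \<otimes> inv \<gamma> T = \<gamma> X [^] q"
      using arg_cong[OF relation, of \<gamma>] by (simp add: c.hom_int_pow)
    then show ?thesis
      by (rule conj_X_pow_if_pow_conj[rotated 2]) auto
  qed
  define \<beta> where "\<beta> = inv\<^bsub>AutoGroup G\<^esub> \<alpha>"
  have \<beta>: "\<beta> \<in> auto G" using A.inv_closed[of \<alpha>] assms by (simp add: carrier_AutoGroup \<beta>_def)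
  interpret a: group_hom G G \<alpha> using assms by (rule auto_group_hom)
  interpret b: group_hom G G \<beta> using \<beta> by (rule auto_group_hom)
  have "\<alpha> \<otimes>\<^bsub>AutoGroup G\<^esub> \<beta> = \<one>\<^bsub>AutoGroup G\<^esub>"
    using assms by (simp add: \<beta>_def carrier_AutoGroup A.r_inv)
  then have "compose (carrier G) \<alpha> \<beta> = (\<lambda>x\<in>carrier G. x)"
    using assms \<beta> mult_AutoGroup[of \<alpha> G \<beta>] by (simp add: AutoGroup_def one_BijGroup)
  then have \<alpha>\<beta>: "\<alpha> (\<beta> X) = X"
    by (metis X_closed compose_eq restrict_apply')
  obtain d m where d: "d \<in> carrier G" "\<alpha> X = d \<otimes> X [^] (m :: int) \<otimes> inv d"
    using conj[OF assms] by blast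
  obtain d' m' where d': "d' \<in> carrier G" "\<beta> X = d' \<otimes> X [^] (m' :: int) \<otimes> inv d'"
    using conj[OF \<beta>] by blast
  define h where "h = inv (\<alpha> d' \<otimes> d)"
  have h: "h \<in> carrier G" using d d' by (simp add: h_def)
  have "X = \<alpha> d' \<otimes> (d \<otimes> X [^] m \<otimes> inv d) [^] m' \<otimes> inv (\<alpha> d')"
    using \<alpha>\<beta> d d' by (simp add: a.hom_int_pow)
  also have "\<dots> = inv h \<otimes> X [^] (m * m') \<otimes> h"
    using d d' by (simp add: h_def conj_int_pow int_pow_pow) (simp add: inv_mult_group m_assoc)
  finally have "X [^] (m * m') = h \<otimes> X \<otimes> inv h"
    using conj_eq_iff[OF h, of "X [^] (m * m')" X] by simp
  then have eq: "X [^] (m * m') \<otimes> h = h \<otimes> X" using h by (simp add: m_assoc)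
  then obtain j :: int where "h = X [^] j"
    using X_pow_conj_X[OF h] by blast
  with eq have "X [^] (m * m' + j) = X [^] (j + 1)"
    by (simp add: int_pow_mult)
  then have "m * m' = 1" by (simp add: X_pow_eq_iff)
  then have "\<bar>m\<bar> = 1" by (auto simp: zmult_eq_1_iff)
  then show ?thesis
    using d a.homh by (auto simp: normalizes_def)
qed

section \<open>The filtration of the automorphism group by denominators\<close>

definition bounded_autos :: "nat \<Rightarrow> (bs_gen word set \<Rightarrow> bs_gen word set) set" where
  "bounded_autos K = {\<alpha> \<in> auto G. \<exists>g e. normalizes g e \<alpha> \<and> denom_bound K (shift g \<alpha>)}"

text \<open>Integers lie in every \<open>n^(-K) \<int>\<close>, so the bound holds for all
  conjugators once it holds for one.\<close>

lemma bounded_autosD: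
  assumes "\<alpha> \<in> bounded_autos K" "normalizes g e \<alpha>"
  shows "denom_bound K (shift g \<alpha>)"
proof -
  obtain h f where "normalizes h f \<alpha>" "denom_bound K (shift h \<alpha>)"
    using assms(1) by (auto simp: bounded_autos_def)
  then show ?thesis
    using shift_diff_Ints[OF _ assms(2)] denom_bound_add[OF _ denom_bound_Ints] by fastforce
qed

lemma exists_bounded_autos:
  assumes "\<alpha> \<in> auto G"
  shows "\<exists>K. \<alpha> \<in> bounded_autos K"
proof -
  interpret group_hom G G \<alpha> using assms by (rule auto_group_hom)
  obtain g e where "normalizes g e \<alpha>" using auto_normalizes[OF assms] by blast
  moreover from this have "\<exists>K. denom_bound K (shift g \<alpha>)"
    unfolding shift_def by (intro exists_denom_bound) (simp add: normalizes_def)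
  ultimately show ?thesis using assms by (auto simp: bounded_autos_def)
qed

lemma bounded_autos_mono: "K \<le> K' \<Longrightarrow> bounded_autos K \<subseteq> bounded_autos K'"
  using denom_bound_mono by (auto simp: bounded_autos_def)

text \<open>The conjugating element itself normalizes, and undoing its conjugation leaves t with
  translation part 0.\<close>

lemma inner_auto_bounded: "inner_auto G \<subseteq> bounded_autos K"
proof
  fix \<alpha> assume \<alpha>: "\<alpha> \<in> inner_auto G"
  then obtain g where g: "g \<in> carrier G" "\<alpha> = (\<lambda>h\<in>carrier G. g \<otimes> h \<otimes> inv g)"
    by (auto simp: inner_auto_def)
  have auto: "\<alpha> \<in> auto G" using \<alpha> inner_auto_subset by blast
  then have "normalizes g 1 \<alpha>"
    using g by (simp add: normalizes_def auto_def)
  moreover have "shift g \<alpha> = 0"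
    using g by (simp add: shift_def m_assoc)
  ultimately show "\<alpha> \<in> bounded_autos K"
    using auto by (auto simp: bounded_autos_def denom_bound_Ints)
qed

lemma bounded_autos_subgroup: "subgroup (bounded_autos K) (AutoGroup G)"
proof -
  interpret A: group "AutoGroup G" by (rule AutoGroup)
  have one: "\<one>\<^bsub>AutoGroup G\<^esub> \<in> bounded_autos K"
    using subgroup.one_closed[OF normal_imp_subgroup[OF normal_inner_auto]] inner_auto_bounded by blast
  show ?thesis
  proof (rule A.subgroupI)
    show "bounded_autos K \<subseteq> carrier (AutoGroup G)"
      by (auto simp: bounded_autos_def carrier_AutoGroup)
    show "bounded_autos K \<noteq> {}" using one by blast
  next
    fix \<alpha> assume \<alpha>: "\<alpha> \<in> bounded_autos K"
    then have a: "\<alpha> \<in> auto G" by (simp add: bounded_autos_def)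
    define \<beta> where "\<beta> = inv\<^bsub>AutoGroup G\<^esub> \<alpha>"
    have b: "\<beta> \<in> auto G"
      using A.inv_closed[of \<alpha>] a by (simp add: carrier_AutoGroup \<beta>_def)
    have id: "\<one>\<^bsub>AutoGroup G\<^esub> = compose (carrier G) \<alpha> \<beta>"
      using mult_AutoGroup[OF a b] a by (simp add: \<beta>_def carrier_AutoGroup A.r_inv)
    obtain g e where g: "normalizes g e \<alpha>" using auto_normalizes[OF a] by blast
    obtain h f where h: "normalizes h f \<beta>" using auto_normalizes[OF b] by blast
    note comp = normalizes_comp[OF g h, folded id]
    \<comment> \<open>The identity lies in \<open>bounded_autos K\<close>, so its shift for the
      composed conjugator is bounded; subtracting the shift of \<alpha> leaves that of \<beta> up to
      the sign \<open>e\<close>.\<close>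
    have "denom_bound K (of_int e * shift h \<beta> + shift g \<alpha> + - 1 * shift g \<alpha>)"
      using bounded_autosD[OF one comp(1)] bounded_autosD[OF \<alpha> g]
      by (intro denom_bound_add[OF _ denom_bound_mult]) (simp_all add: comp(2))
    then have "denom_bound K (of_int e * shift h \<beta>)" by simp
    then have "denom_bound K (of_int e * (of_int e * shift h \<beta>))"
      by (rule denom_bound_mult) simp
    moreover have "e * e = 1" using g by (auto simp: normalizes_def abs_if split: if_splits)
    then have "(of_int e * of_int e :: rat) = 1" by (metis of_int_1 of_int_mult)
    ultimately have "denom_bound K (shift h \<beta>)" by (metis mult.assoc mult_1)
    then show "inv\<^bsub>AutoGroup G\<^esub> \<alpha> \<in> bounded_autos K"
      using b h by (auto simp: bounded_autos_def \<beta>_def)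
  next
    fix \<alpha> \<beta> assume \<alpha>: "\<alpha> \<in> bounded_autos K" and \<beta>: "\<beta> \<in> bounded_autos K"
    then have a: "\<alpha> \<in> auto G" and b: "\<beta> \<in> auto G" by (auto simp: bounded_autos_def)
    obtain g e where g: "normalizes g e \<alpha>" "denom_bound K (shift g \<alpha>)"
      using \<alpha> by (auto simp: bounded_autos_def)
    obtain h f where h: "normalizes h f \<beta>" "denom_bound K (shift h \<beta>)"
      using \<beta> by (auto simp: bounded_autos_def)
    have "denom_bound K (of_int e * shift h \<beta> + shift g \<alpha>)"
      using g h by (intro denom_bound_add denom_bound_mult) simp_all
    then show "\<alpha> \<otimes>\<^bsub>AutoGroup G\<^esub> \<beta> \<in> bounded_autos K"
      using normalizes_comp[OF g(1) h(1)] A.m_closed[of \<alpha> \<beta>] a b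
      by (auto simp: bounded_autos_def mult_AutoGroup carrier_AutoGroup)
  qed
qed

section \<open>Twist automorphisms with arbitrarily large denominators\<close>

text \<open>Conjugation by \<open>z\<close> fixes x^p, and hence also x^q because \<open>p\<close>
  divides \<open>q\<close>. The relation thus survives when x is conjugated and t is kept.\<close>

lemma twist_exists:
  assumes z: "z \<in> carrier G" and comm: "z \<otimes> X [^] p = X [^] p \<otimes> z"
  obtains h where "h \<in> hom G G" "h X = inv z \<otimes> X \<otimes> z" "h T = T"
proof -
  have "(inv z \<otimes> X \<otimes> z) [^] p = inv z \<otimes> X [^] p \<otimes> z"
    using z conj_int_pow[of "inv z" X p] by simp
  also have "\<dots> = X [^] p"
    using z comm by (simp add: m_assoc flip: comm)
  finally have pow: "(inv z \<otimes> X \<otimes> z) [^] p = X [^] p" .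
  then have "(inv z \<otimes> X \<otimes> z) [^] q = X [^] q"
    using z by (metis X_closed int_pow_pow inv_closed m_closed q_eq)
  then show ?thesis
    using lift[OF group_axioms, of "inv z \<otimes> X \<otimes> z" T] z pow relation that by auto
qed

definition twist_elt :: "nat \<Rightarrow> bs_gen word set" where
  "twist_elt k = inv (T [^] k) \<otimes> X [^] p \<otimes> T [^] k"

lemma twist_elt_closed [simp, intro]: "twist_elt k \<in> carrier G"
  by (simp add: twist_elt_def)

text \<open>Conjugation by t^k takes x^p to its \<open>n ^ k\<close>-th power. Undoing it exhibits
  x^p as a power of \<open>twist_elt k\<close>.\<close>

lemma twist_elt_commutes: "twist_elt k \<otimes> X [^] p = X [^] p \<otimes> twist_elt k"
proof -
  have conj: "T [^] k \<otimes> X [^] p \<otimes> inv (T [^] k) = X [^] (p * n ^ k)"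
  proof (induction k)
    case (Suc k)
    have "T [^] Suc k \<otimes> X [^] p \<otimes> inv (T [^] Suc k) = T [^] k \<otimes> (T \<otimes> X [^] p \<otimes> inv T) \<otimes> inv (T [^] k)"
      by (simp add: inv_mult_group m_assoc)
    also have "\<dots> = (T [^] k \<otimes> X [^] p \<otimes> inv (T [^] k)) [^] n"
      by (simp add: relation conj_int_pow int_pow_pow flip: q_eq)
    also have "\<dots> = X [^] (p * n ^ Suc k)"
      unfolding Suc by (simp add: int_pow_pow ac_simps)
    finally show ?case .
  qed simp
  have "twist_elt k [^] (n ^ k) = inv (T [^] k) \<otimes> X [^] (p * n ^ k) \<otimes> T [^] k"
    using conj_int_pow[of "inv (T [^] k)" "X [^] p" "n ^ k"] by (simp add: twist_elt_def int_pow_pow)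
  also have "\<dots> = X [^] p"
    using conj by (simp add: conj_eq_iff)
  finally have pow: "X [^] p = twist_elt k [^] (n ^ k)" ..
  have "twist_elt k [^] (1 + n ^ k) = twist_elt k [^] (n ^ k + 1)"
    by (simp add: add.commute)
  then show ?thesis
    unfolding pow by (simp add: int_pow_mult del: add.commute)
qed

lemma expt_off_T_pow [simp]: "expt (T [^] (k :: nat)) = int k" "off (T [^] (k :: nat)) = 0"
  by (induction k) auto

lemma expt_off_twist_elt:
  "expt (twist_elt k) = 0" "off (twist_elt k) = of_int p / of_int n ^ k"
  using n_nonzero by (simp_all add: twist_elt_def power_int_minus field_simps)

text \<open>The inverse is the twist by \<open>inv z\<close>. Both twists fix x^p and t, hence also
  \<open>z\<close>, which is a product of these and their inverses; so both composites fix the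
  generators. The shift is the translation part of \<open>z \<otimes> T \<otimes> inv z\<close>,
  namely \<open>p / n^k - n * p / n^k\<close>.\<close>

lemma twist_auto:
  obtains \<alpha> where "\<alpha> \<in> auto G" "normalizes (inv (twist_elt k)) 1 \<alpha>"
    "shift (inv (twist_elt k)) \<alpha> = of_int (p * (1 - n)) / of_int n ^ k"
proof -
  define z where "z = twist_elt k"
  have z: "z \<in> carrier G" and comm: "z \<otimes> X [^] p = X [^] p \<otimes> z"
    using twist_elt_commutes by (simp_all add: z_def)
  have fix_z: "h z = z" if h: "h \<in> hom G G" "h (X [^] p) = X [^] p" "h T = T" for h
  proof -
    interpret group_hom G G h using h(1) by (rule group_homI)
    show ?thesis using h by (simp add: z_def twist_elt_def hom_nat_pow)
  qed
  have conj_pow: "(inv y \<otimes> X \<otimes> y) [^] p = X [^] p" if "y \<in> carrier G" "y \<otimes> X [^] p = X [^] p \<otimes> y" for y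
    using that conj_int_pow[of "inv y" X p] by (simp add: m_assoc flip: that(2))
  have comm': "inv z \<otimes> X [^] p = X [^] p \<otimes> inv z"
  proof -
    have "inv z \<otimes> X [^] p = inv z \<otimes> (X [^] p \<otimes> z) \<otimes> inv z"
      using z by (simp add: m_assoc)
    also have "\<dots> = X [^] p \<otimes> inv z"
      using z by (simp add: m_assoc flip: comm)
    finally show ?thesis .
  qed
  obtain h where h: "h \<in> hom G G" "h X = inv z \<otimes> X \<otimes> z" "h T = T"
    using twist_exists[OF z comm] .
  obtain h' where h': "h' \<in> hom G G" "h' X = z \<otimes> X \<otimes> inv z" "h' T = T"
    using twist_exists[OF inv_closed[OF z] comm'] z by auto
  interpret h: group_hom G G h using h(1) by (rule group_homI)
  interpret h': group_hom G G h' using h'(1) by (rule group_homI)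
  have hz: "h z = z"
    using h conj_pow[OF z comm] by (intro fix_z) (simp_all add: h.hom_int_pow)
  have h'z: "h' z = z"
    using h' conj_pow[OF inv_closed[OF z] comm'] z by (intro fix_z) (simp_all add: h'.hom_int_pow)
  have id: "(\<lambda>g. g) \<in> hom G G" by (simp add: hom_def)
  have "h' (h g) = g" if "g \<in> carrier G" for g
    using hom_eqI[OF group_axioms Group.hom_compose[OF h(1) h'(1)] id _ _ that] z
    by (simp add: h h' h'z m_assoc)
  moreover have "h (h' g) = g" if "g \<in> carrier G" for g
    using hom_eqI[OF group_axioms Group.hom_compose[OF h'(1) h(1)] id _ _ that] z
    by (simp add: h h' hz m_assoc)
  ultimately have "bij_betw h (carrier G) (carrier G)"
    by (intro bij_betw_byWitness[where f' = h']) auto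
  then have bij: "restrict h (carrier G) \<in> Bij (carrier G)"
    by (simp add: Bij_def bij_betw_restrict_eq)
  have hom: "restrict h (carrier G) \<in> hom G G"
    using h(1) by (simp add: hom_def Pi_iff)
  show ?thesis
  proof
    show "restrict h (carrier G) \<in> auto G" using bij hom by (simp add: auto_def)
    show "normalizes (inv (twist_elt k)) 1 (restrict h (carrier G))"
      using hom by (simp add: normalizes_def h z_def)
    show "shift (inv (twist_elt k)) (restrict h (carrier G)) = of_int (p * (1 - n)) / of_int n ^ k"
      using n_nonzero by (simp add: shift_def h expt_off_twist_elt field_simps)
  qed
qed

lemma exists_unbounded_auto: "\<exists>\<alpha>\<in>auto G. \<alpha> \<notin> bounded_autos K"
proof -
  \<comment> \<open>With \<open>M\<close> the absolute value of \<open>p * (1 - n)\<close>, the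
    inequalities \<open>M < 2 ^ M \<le> \<bar>n\<bar> ^ M\<close> show that \<open>n ^ M\<close>
    does not divide this nonzero numerator. Hence a denominator \<open>n ^ (K + M)\<close> cannot
    reduce to \<open>n ^ K\<close>.\<close>
  define M where "M = nat (p * \<bar>1 - n\<bar>)"
  obtain \<alpha> where \<alpha>: "\<alpha> \<in> auto G" "normalizes (inv (twist_elt (K + M))) 1 \<alpha>"
    "shift (inv (twist_elt (K + M))) \<alpha> = of_int (p * (1 - n)) / of_int n ^ (K + M)"
    by (rule twist_auto)
  have "\<not> denom_bound K (of_int (p * (1 - n)) / of_int n ^ (K + M))"
  proof
    assume "denom_bound K (of_int (p * (1 - n)) / of_int n ^ (K + M))"
    then have "(of_int (p * (1 - n)) / of_int n ^ M :: rat) \<in> \<int>"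
      using n_nonzero by (simp add: denom_bound_def power_add)
    then obtain c where "(of_int (p * (1 - n)) / of_int n ^ M :: rat) = of_int c"
      by (auto elim: Ints_cases)
    then have "(of_int (p * (1 - n)) :: rat) = of_int (c * n ^ M)"
      using n_nonzero by (simp add: field_simps)
    then have eq: "p * (1 - n) = c * n ^ M"
      by (simp only: of_int_eq_iff)
    have nz: "p * (1 - n) \<noteq> 0" using p_gt_1 abs_n by auto
    then have "1 \<le> \<bar>c\<bar>" unfolding eq by auto
    then have "\<bar>n\<bar> ^ M \<le> \<bar>c\<bar> * \<bar>n\<bar> ^ M"
      using mult_right_mono[of 1 "\<bar>c\<bar>" "\<bar>n\<bar> ^ M"] by simp
    also have "\<dots> = p * \<bar>1 - n\<bar>"
      using arg_cong[OF eq, of abs] p_gt_1 by (simp add: abs_mult power_abs)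
    also have "\<dots> = int M"
      using p_gt_1 by (simp add: M_def)
    finally have "\<bar>n\<bar> ^ M \<le> int M" .
    moreover have "(2 :: int) ^ M \<le> \<bar>n\<bar> ^ M" using abs_n by (intro power_mono) auto
    moreover have "int M < 2 ^ M" by (rule of_nat_less_two_power)
    ultimately show False by linarith
  qed
  then have "\<alpha> \<notin> bounded_autos K"
    using bounded_autosD[OF _ \<alpha>(2)] \<alpha>(3) by metis
  with \<alpha>(1) show ?thesis by blast
qed

section \<open>The filtration against finite generation\<close>

theorem not_finitely_generated_Out: "\<not> finitely_generated (Out G)"
proof
  assume "finitely_generated (Out G)"
  then obtain S where S: "finite S" "S \<subseteq> carrier (Out G)" "generate (Out G) S = carrier (Out G)"
    by (auto simp: finitely_generated_def)
  interpret A: group "AutoGroup G" by (rule AutoGroup)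
  interpret O: group "Out G" by (rule group_Out)
  interpret I: normal "inner_auto G" "AutoGroup G" by (rule normal_inner_auto)
  let ?c = "\<lambda>\<alpha>. inner_auto G #>\<^bsub>AutoGroup G\<^esub> \<alpha>"
  have hom: "group_hom (AutoGroup G) (Out G) ?c"
    using I.r_coset_hom_Mod by (intro group_hom.intro group_hom_axioms.intro A.group_axioms O.group_axioms)
      (simp add: Out_def)
  have carr: "carrier (Out G) = ?c ` auto G"
    by (auto simp: Out_def FactGroup_def RCOSETS_def carrier_AutoGroup)
  have "\<forall>s\<in>S. \<exists>K. s \<in> ?c ` bounded_autos K"
    using S(2) exists_bounded_autos unfolding carr by blast
  then obtain K where K: "\<forall>s\<in>S. s \<in> ?c ` bounded_autos (K s)" by metis
  \<comment> \<open>The largest of the finitely many bounds serves all generators; inserting 0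
    covers an empty \<open>S\<close>.\<close>
  define N where "N = Max (insert 0 (K ` S))"
  have "S \<subseteq> ?c ` bounded_autos N"
  proof
    fix s assume s: "s \<in> S"
    then have "K s \<le> N" unfolding N_def using S(1) by (intro Max_ge) auto
    from bounded_autos_mono[OF this] show "s \<in> ?c ` bounded_autos N"
      using bspec[OF K s] by (rule subsetD[OF image_mono])
  qed
  moreover have "subgroup (?c ` bounded_autos N) (Out G)"
    by (rule group_hom.subgroup_img_is_subgroup[OF hom bounded_autos_subgroup])
  ultimately have gen: "carrier (Out G) \<subseteq> ?c ` bounded_autos N"
    using O.generate_subgroup_incl S(3) by metis
  obtain \<alpha> where \<alpha>: "\<alpha> \<in> auto G" "\<alpha> \<notin> bounded_autos N"
    using exists_unbounded_auto by blast
  have "?c \<alpha> \<in> ?c ` bounded_autos N" using \<alpha>(1) gen carr by blast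
  then obtain \<beta> where \<beta>: "\<beta> \<in> bounded_autos N" "?c \<alpha> = ?c \<beta>" by blast
  \<comment> \<open>Equality of cosets is lifted back to automorphisms: \<alpha> differs from
    \<beta> by an inner automorphism, and those lie in every \<open>bounded_autos N\<close>.\<close>
  have "\<alpha> \<in> ?c \<alpha>"
    using \<alpha>(1) I.subgroup_axioms by (intro A.rcos_self) (simp_all add: carrier_AutoGroup)
  then obtain \<iota> where "\<iota> \<in> inner_auto G" "\<alpha> = \<iota> \<otimes>\<^bsub>AutoGroup G\<^esub> \<beta>"
    unfolding \<beta>(2) by (auto simp: r_coset_def)
  then have "\<alpha> \<in> bounded_autos N"
    using inner_auto_bounded \<beta>(1) subgroup.m_closed[OF bounded_autos_subgroup] by blast
  with \<alpha>(2) show False by contradiction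
qed

end

theorem theorem4p3:
  fixes p q :: int
  assumes "p > 1" and "properly_divides p q"
  shows "\<not> finitely_generated (Out (BS p q))"
proof -
  obtain n where "q = p * n" "\<bar>n\<bar> > 1"
    using assms(2) by (auto simp: properly_divides_def)
  then interpret baumslag_solitar p q n "BS p q"
    using assms(1) by unfold_locales auto
  show ?thesis by (rule not_finitely_generated_Out)
qed

end
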